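(* Let $(\mu,\mu')$ be a regular couple of characters of $\mathcal O_r^\times$ and let $\Pi_{\mu,\mu'}$ be the associated principal split representation of $GL(2,\mathcal O_r)$. For every $0\le i\le r-1$, $\alpha\in\mathcal O_r^\times$ and $\beta\in\mathcal O_r$, the character of $\Pi_{\mu,\mu'}$ at $B_{i,\alpha,\beta}=\begin{pmatrix}\alpha&\varpi^{i+1}\beta\\ \varpi^i&\alpha\end{pmatrix}$ is $$\mathrm{tr}(B_{i,\alpha,\beta}|_{\Pi_{\mu,\mu'}})=\delta_{i,r-1}\,q^{r-1}\mu(\alpha)\mu'(\alpha),$$ where $\delta_{i,r-1}$ is the Kronecker symbol.
   Context: $F$ is a non-archimedean local field with ring of integers $\mathcal O$, uniformizer $\varpi$, residue field of cardinality $q$ and characteristic $p\neq2$. $r\ge2$ is an even integer, $l=r/2$, $\mathcal O_r=\mathcal O/\varpi^r\mathcal O$, $G^{(r)}=GL(2,\mathcal O_r)$. A couple $(\mu,\mu')$ of characters $\mathcal O_r^\times\to\mathbb C^\times$ is called regular if the restriction of $\mu\mu'^{-1}$ to $1+\varpi^l\mathcal O_r$ is primitive, i.e. nontrivial on $1+\varpi^{r-1}\mathcal O_r$. Let $T=\left\{\begin{pmatrix}s_1&\varpi^ly\\ \varpi^lz&s_2\end{pmatrix}: s_1,s_2\in\mathcal O_r^\times,\ y,z\in\mathcal O_r\right\}\subset G^{(r)}$. For a regular couple, $\mu\boxtimes\mu'$ is the one-dimensional representation of $T$ given by $(\mu\boxtimes\mu')\begin{pmatrix}s_1&\varpi^ly\\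 \varpi^lz&s_2\end{pmatrix}=\mu(s_1)\mu'(s_2)$, and $\Pi_{\mu,\mu'}=\mathrm{Ind}_T^{G^{(r)}}(\mu\boxtimes\mu')$. *)

theory Defs
  imports
    "HOL-Algebra.QuotRing"
    "HOL-Algebra.Multiplicative_Group"
    "HOL-Library.Function_Algebras"
    Complex_Main
begin

section \<open>Non-archimedean local fields\<close>

text \<open>
  A non-archimedean local field is a field, complete for a normalised discrete valuation \<open>v\<close>,
  with finite residue field. The value of \<open>v\<close> at zero is irrelevant:
  \<open>val_ge F v k x\<close> expresses \<open>v x \<ge> k\<close> under the convention \<open>v 0 = \<infinity>\<close>.
\<close>

definition val_ge :: "('a, 'm) ring_scheme \<Rightarrow> ('a \<Rightarrow> int) \<Rightarrow> int \<Rightarrow> 'a \<Rightarrow> bool" where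
  "val_ge F v k x \<longleftrightarrow> x = \<zero>\<^bsub>F\<^esub> \<or> k \<le> v x"

definition val_ring :: "('a, 'm) ring_scheme \<Rightarrow> ('a \<Rightarrow> int) \<Rightarrow> ('a, 'm) ring_scheme" where
  "val_ring F v = F\<lparr>carrier := {x \<in> carrier F. val_ge F v 0 x}\<rparr>"

definition val_ideal :: "('a, 'm) ring_scheme \<Rightarrow> ('a \<Rightarrow> int) \<Rightarrow> 'a set" where
  "val_ideal F v = {x \<in> carrier F. val_ge F v 1 x}"

definition residue_field :: "('a, 'm) ring_scheme \<Rightarrow> ('a \<Rightarrow> int) \<Rightarrow> 'a set ring" where
  "residue_field F v = val_ring F v Quot val_ideal F v"

locale nonarch_local_field = field F for F :: "('a, 'm) ring_scheme" (structure) +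
  fixes v :: "'a \<Rightarrow> int"
  assumes val_mult:
      "\<lbrakk>x \<in> carrier F; y \<in> carrier F; x \<noteq> \<zero>; y \<noteq> \<zero>\<rbrakk> \<Longrightarrow> v (x \<otimes> y) = v x + v y"
    and val_add:
      "\<lbrakk>x \<in> carrier F; y \<in> carrier F; val_ge F v k x; val_ge F v k y\<rbrakk> \<Longrightarrow> val_ge F v k (x \<oplus> y)"
    and val_normalised: "\<exists>x \<in> carrier F. x \<noteq> \<zero> \<and> v x = 1"
    and val_complete:
      "\<lbrakk>\<And>n::nat. s n \<in> carrier F;
        \<And>k. \<exists>N. \<forall>m\<ge>N. \<forall>n\<ge>N. val_ge F v k (s m \<ominus> s n)\<rbrakk>
       \<Longrightarrow> \<exists>x \<in> carrier F. \<forall>k. \<exists>N. \<forall>n\<ge>N. val_ge F v k (s n \<ominus> x)"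
    and finite_residue_field: "finite (carrier (residue_field F v))"

definition uniformizer :: "('a, 'm) ring_scheme \<Rightarrow> ('a \<Rightarrow> int) \<Rightarrow> 'a \<Rightarrow> bool" where
  "uniformizer F v w \<longleftrightarrow> w \<in> carrier F \<and> w \<noteq> \<zero>\<^bsub>F\<^esub> \<and> v w = 1"

definition residue_card :: "('a, 'm) ring_scheme \<Rightarrow> ('a \<Rightarrow> int) \<Rightarrow> nat" where
  "residue_card F v = card (carrier (residue_field F v))"

text \<open>The characteristic of the finite field \<open>k\<close> is the order of \<open>1\<close> in its additive group.\<close>

definition residue_char :: "('a, 'm) ring_scheme \<Rightarrow> ('a \<Rightarrow> int) \<Rightarrow> nat" where
  "residue_char F v =
     group.ord (add_monoid (residue_field F v)) \<one>\<^bsub>residue_field F v\<^esub>"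

definition trunc_ideal ::
  "('a, 'm) ring_scheme \<Rightarrow> ('a \<Rightarrow> int) \<Rightarrow> 'a \<Rightarrow> nat \<Rightarrow> 'a set" where
  "trunc_ideal F v w r = PIdl\<^bsub>val_ring F v\<^esub> (w [^]\<^bsub>val_ring F v\<^esub> r)"

definition trunc_ring ::
  "('a, 'm) ring_scheme \<Rightarrow> ('a \<Rightarrow> int) \<Rightarrow> 'a \<Rightarrow> nat \<Rightarrow> 'a set ring" where
  "trunc_ring F v w r = val_ring F v Quot trunc_ideal F v w r"

text \<open>The image of the uniformizer \<open>w\<close> in the truncated ring.\<close>

definition trunc_unif ::
  "('a, 'm) ring_scheme \<Rightarrow> ('a \<Rightarrow> int) \<Rightarrow> 'a \<Rightarrow> nat \<Rightarrow> 'a set" where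
  "trunc_unif F v w r = trunc_ideal F v w r +>\<^bsub>val_ring F v\<^esub> w"


section \<open>The group \<open>GL(2, R)\<close>\<close>

datatype 'b mat2 = Mat2 (ent11: 'b) (ent12: 'b) (ent21: 'b) (ent22: 'b)

definition mat2_monoid :: "('b, 'n) ring_scheme \<Rightarrow> 'b mat2 monoid" where
  "mat2_monoid R =
    \<lparr>carrier = {M. set_mat2 M \<subseteq> carrier R},
     monoid.mult = (\<lambda>M N. Mat2
       (ent11 M \<otimes>\<^bsub>R\<^esub> ent11 N \<oplus>\<^bsub>R\<^esub> ent12 M \<otimes>\<^bsub>R\<^esub> ent21 N)
       (ent11 M \<otimes>\<^bsub>R\<^esub> ent12 N \<oplus>\<^bsub>R\<^esub> ent12 M \<otimes>\<^bsub>R\<^esub> ent22 N)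
       (ent21 M \<otimes>\<^bsub>R\<^esub> ent11 N \<oplus>\<^bsub>R\<^esub> ent22 M \<otimes>\<^bsub>R\<^esub> ent21 N)
       (ent21 M \<otimes>\<^bsub>R\<^esub> ent12 N \<oplus>\<^bsub>R\<^esub> ent22 M \<otimes>\<^bsub>R\<^esub> ent22 N)),
     one = Mat2 \<one>\<^bsub>R\<^esub> \<zero>\<^bsub>R\<^esub> \<zero>\<^bsub>R\<^esub> \<one>\<^bsub>R\<^esub>\<rparr>"

definition GL2 :: "('b, 'n) ring_scheme \<Rightarrow> 'b mat2 monoid" where
  "GL2 R = units_of (mat2_monoid R)"


section \<open>Induced representations and their characters\<close>

interpretation cfun: vector_space "\<lambda>(c::complex) (f :: 'x \<Rightarrow> complex) x. c * f x"
  by unfold_locales (auto simp: fun_eq_iff algebra_simps)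

text \<open>
  Functions on the carrier of a group are represented by functions on the whole type which
  vanish outside the carrier.
\<close>

definition ind_space ::
  "('g, 'n) monoid_scheme \<Rightarrow> 'g set \<Rightarrow> ('g \<Rightarrow> complex) \<Rightarrow> ('g \<Rightarrow> complex) set" where
  "ind_space G H \<chi> =
    {f. (\<forall>x. x \<notin> carrier G \<longrightarrow> f x = 0) \<and>
        (\<forall>h \<in> H. \<forall>x \<in> carrier G. f (h \<otimes>\<^bsub>G\<^esub> x) = \<chi> h * f x)}"

definition ind_action ::
  "('g, 'n) monoid_scheme \<Rightarrow> 'g \<Rightarrow> ('g \<Rightarrow> complex) \<Rightarrow> 'g \<Rightarrow> complex" where
  "ind_action G g f = (\<lambda>x. if x \<in> carrier G then f (x \<otimes>\<^bsub>G\<^esub> g) else 0)"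

text \<open>
  The trace of an endomorphism of a finite-dimensional space of functions is the sum of the
  diagonal coefficients in some basis; it does not depend on the choice of the basis.
\<close>

definition trace_on ::
  "('x \<Rightarrow> complex) set \<Rightarrow> (('x \<Rightarrow> complex) \<Rightarrow> ('x \<Rightarrow> complex)) \<Rightarrow> complex" where
  "trace_on V A =
    (let B = (SOME B. B \<subseteq> V \<and> cfun.independent B \<and> V \<subseteq> cfun.span B)
     in \<Sum>b\<in>B. cfun.representation B (A b) b)"

lemma trace_basis_independent:
  fixes A :: "('x \<Rightarrow> complex) \<Rightarrow> ('x \<Rightarrow> complex)"
  assumes lin: "Vector_Spaces.linear (\<lambda>(c::complex) (f :: 'x \<Rightarrow> complex) x. c * f x)
                  (\<lambda>(c::complex) (f :: 'x \<Rightarrow> complex) x. c * f x) A"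
    and stable: "\<And>f. f \<in> V \<Longrightarrow> A f \<in> V"
    and B: "finite B" "B \<subseteq> V" "cfun.independent B" "V \<subseteq> cfun.span B"
    and C: "finite C" "C \<subseteq> V" "cfun.independent C" "V \<subseteq> cfun.span C"
  shows "(\<Sum>b\<in>B. cfun.representation B (A b) b) = (\<Sum>c\<in>C. cfun.representation C (A c) c)"
proof -
  interpret A: Vector_Spaces.linear "\<lambda>(c::complex) (f :: 'x \<Rightarrow> complex) x. c * f x"
    "\<lambda>(c::complex) (f :: 'x \<Rightarrow> complex) x. c * f x" A by (rule lin)
  have AB: "A c \<in> cfun.span B" if "c \<in> C" for c using that stable B C by blast
  have 1: "cfun.representation B (A b) b =
      (\<Sum>c\<in>C. cfun.representation C b c * cfun.representation B (A c) b)" if b: "b \<in> B" for b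
  proof -
    have "b = (\<Sum>c\<in>C. (\<lambda>x. cfun.representation C b c * c x))"
      using cfun.sum_representation_eq[OF C(3) _ C(1) order_refl, of b] b B(2) C(4) by auto
    then have "A b = A (\<Sum>c\<in>C. (\<lambda>x. cfun.representation C b c * c x))"
      by (rule arg_cong)
    also have "\<dots> = (\<Sum>c\<in>C. A (\<lambda>x. cfun.representation C b c * c x))"
      by (rule A.sum)
    also have "\<dots> = (\<Sum>c\<in>C. (\<lambda>x. cfun.representation C b c * A c x))"
      by (simp add: A.scale)
    finally have "cfun.representation B (A b) =
        (\<lambda>b'. \<Sum>c\<in>C. cfun.representation B (\<lambda>x. cfun.representation C b c * A c x) b')"
      using cfun.representation_sum[OF B(3), of C
          "\<lambda>c. (\<lambda>x. cfun.representation C b c * A c x)"] cfun.span_scale[OF AB] by simp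
    then show ?thesis
      by (simp add: cfun.representation_scale[OF B(3) AB] cong: sum.cong)
  qed
  have 2: "cfun.representation C (A c) c =
      (\<Sum>b\<in>B. cfun.representation C b c * cfun.representation B (A c) b)" if c: "c \<in> C" for c
  proof -
    have "A c = (\<Sum>b\<in>B. (\<lambda>x. cfun.representation B (A c) b * b x))"
      using cfun.sum_representation_eq[OF B(3) AB[OF c] B(1) order_refl] by simp
    then have "cfun.representation C (A c) = cfun.representation C
        (\<Sum>b\<in>B. (\<lambda>x. cfun.representation B (A c) b * b x))"
      by (rule arg_cong)
    moreover have bC: "b \<in> cfun.span C" if "b \<in> B" for b using that B C by blast
    ultimately have "cfun.representation C (A c) =
        (\<lambda>c'. \<Sum>b\<in>B. cfun.representation C (\<lambda>x. cfun.representation B (A c) b * b x) c')"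
      using cfun.representation_sum[OF C(3), of B
          "\<lambda>b. (\<lambda>x. cfun.representation B (A c) b * b x)"] cfun.span_scale[OF bC] by simp
    then show ?thesis
      by (simp add: cfun.representation_scale[OF C(3) bC] cong: sum.cong)
         (simp add: mult.commute)
  qed
  show ?thesis
    using sum.swap[of "\<lambda>b c. cfun.representation C b c * cfun.representation B (A c) b" C B]
    by (simp add: 1 2 cong: sum.cong)
qed

definition ind_character ::
  "('g, 'n) monoid_scheme \<Rightarrow> 'g set \<Rightarrow> ('g \<Rightarrow> complex) \<Rightarrow> 'g \<Rightarrow> complex" where
  "ind_character G H \<chi> g = trace_on (ind_space G H \<chi>) (ind_action G g)"


section \<open>Principal split representations\<close>

definition complex_units :: "complex monoid" where
  "complex_units = \<lparr>carrier = UNIV - {0}, monoid.mult = (*), one = 1\<rparr>"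

text \<open>
  In the following, \<open>R\<close> is the truncated ring of level \<open>r\<close> and \<open>t\<close> the image of the uniformizer
  in it.
\<close>

definition regular_couple ::
  "('b, 'n) ring_scheme \<Rightarrow> 'b \<Rightarrow> nat \<Rightarrow> ('b \<Rightarrow> complex) \<Rightarrow> ('b \<Rightarrow> complex) \<Rightarrow> bool" where
  "regular_couple R t r \<mu> \<mu>' \<longleftrightarrow>
    \<mu> \<in> hom (units_of R) complex_units \<and> \<mu>' \<in> hom (units_of R) complex_units \<and>
    (\<exists>u \<in> {\<one>\<^bsub>R\<^esub> \<oplus>\<^bsub>R\<^esub> t [^]\<^bsub>R\<^esub> (r - 1) \<otimes>\<^bsub>R\<^esub> x | x. x \<in> carrier R}. \<mu> u * inverse (\<mu>' u) \<noteq> 1)"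

definition split_subgroup :: "('b, 'n) ring_scheme \<Rightarrow> 'b \<Rightarrow> nat \<Rightarrow> 'b mat2 set" where
  "split_subgroup R t l =
    {Mat2 s1 (t [^]\<^bsub>R\<^esub> l \<otimes>\<^bsub>R\<^esub> y) (t [^]\<^bsub>R\<^esub> l \<otimes>\<^bsub>R\<^esub> z) s2 | s1 s2 y z.
      s1 \<in> Units R \<and> s2 \<in> Units R \<and> y \<in> carrier R \<and> z \<in> carrier R}"

definition boxtimes :: "('b \<Rightarrow> complex) \<Rightarrow> ('b \<Rightarrow> complex) \<Rightarrow> 'b mat2 \<Rightarrow> complex" where
  "boxtimes \<mu> \<mu>' M = \<mu> (ent11 M) * \<mu>' (ent22 M)"

definition principal_split_character ::
  "('b, 'n) ring_scheme \<Rightarrow> 'b \<Rightarrow> nat \<Rightarrow> ('b \<Rightarrow> complex) \<Rightarrow> ('b \<Rightarrow> complex) \<Rightarrow> 'b mat2 \<Rightarrow> complex" where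
  "principal_split_character R t r \<mu> \<mu>' =
    ind_character (GL2 R) (split_subgroup R t (r div 2)) (boxtimes \<mu> \<mu>')"

definition B_mat :: "('b, 'n) ring_scheme \<Rightarrow> 'b \<Rightarrow> nat \<Rightarrow> 'b \<Rightarrow> 'b \<Rightarrow> 'b mat2" where
  "B_mat R t i \<alpha> \<beta> = Mat2 \<alpha> (t [^]\<^bsub>R\<^esub> (i + 1) \<otimes>\<^bsub>R\<^esub> \<beta>) (t [^]\<^bsub>R\<^esub> i) \<alpha>"

end

theory Submission
  imports Defs "HOL-Algebra.Subrings"
begin

text \<open>
  By Frobenius' formula, the order of \<open>T\<close> times the character of the induced representation at
  \<open>g\<close> is the sum of \<open>\<mu> \<boxtimes> \<mu>'\<close> over those \<open>x\<close> in \<open>GL\<^sub>2\<close> for which \<open>x g x\<inverse>\<close> lies in \<open>T\<close>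
  (\<open>ind_character_frobenius\<close>). For \<open>g = B\<close> write \<open>B = \<alpha> + t\<^sup>i N\<close> with \<open>N\<close> the matrix with rows
  \<open>(0, e)\<close> and \<open>(1, 0)\<close>, where \<open>e = t \<beta>\<close>. Modulo \<open>t\<close> the matrix \<open>N\<close> is nilpotent and nonzero,
  and so is every conjugate \<open>X = x N x\<inverse>\<close>; hence one of the off-diagonal entries of \<open>X\<close> is a unit.
  Which one it is depends on the lower right entry \<open>d\<close> of \<open>x\<close>: if \<open>d\<close> is a unit then
  \<open>X\<^sub>2\<^sub>1\<close> is one (\<open>conj21_unit\<close>), and otherwise \<open>X\<^sub>1\<^sub>2\<close> is (\<open>conj12_unit\<close>).

  Let \<open>r = 2 l\<close>. If \<open>i < l\<close>, no conjugate \<open>\<alpha> + t\<^sup>i X\<close> has both off-diagonal entries divisible by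
  \<open>t\<^sup>l\<close>, so the sum is empty. If \<open>i \<ge> l\<close>, every conjugate lies in \<open>T\<close>, and the summand
  is \<open>\<mu> (\<alpha> + t\<^sup>i X\<^sub>1\<^sub>1) \<mu>' (\<alpha> - t\<^sup>i X\<^sub>1\<^sub>1)\<close>, because \<open>X\<close> has trace zero. Multiplying \<open>x\<close> from
  the left by the unipotent matrix with upper right entry \<open>s\<close> changes \<open>X\<^sub>1\<^sub>1\<close> to
  \<open>X\<^sub>1\<^sub>1 + s X\<^sub>2\<^sub>1\<close>, and the one with lower left entry \<open>s\<close> changes it to
  \<open>X\<^sub>1\<^sub>1 - s X\<^sub>1\<^sub>2\<close>. For \<open>s = t\<^bsup>r-1-i\<^esup> z\<close> this multiplies the summand by
  \<open>\<psi> (\<kappa> z)\<close>, where \<open>\<psi>\<close> is the additive character \<open>u \<mapsto> (\<mu> / \<mu>') (1 + t\<^bsup>r-1\<^esup> u)\<close> and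
  \<open>\<kappa>\<close> is a unit multiple of the off-diagonal entry (\<open>summand_perturb\<close>). Regularity says that \<open>\<psi>\<close>
  is nontrivial, so averaging over \<open>z\<close> kills a sum as soon as that entry is a unit and its range is
  stable under the substitution. The upper unipotents keep \<open>d\<close> and so kill the sum over
  the \<open>x\<close> with \<open>d\<close> a unit (\<open>sum_summand_unit_corner\<close>). The lower ones change \<open>d\<close> by a multiple
  of \<open>s\<close>, so for \<open>i < r - 1\<close> they keep the nonunits and kill the sum over the remaining
  \<open>x\<close> (\<open>sum_summand_nonunit_corner\<close>).

  For \<open>i = r - 1\<close> the lower substitution is lost, but now \<open>X\<^sub>1\<^sub>1\<close> is divisible by \<open>t\<close> whenever \<open>d\<close>
  is, so every remaining summand equals \<open>\<mu> \<alpha> \<mu>' \<alpha>\<close>. An invertible matrix with nonunit \<open>d\<close> is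
  given by any \<open>a\<close>, units \<open>b\<close> and \<open>c\<close>, and any nonunit \<open>d\<close>, so there are
  \<open>q\<^sup>r q\<^bsup>r-1\<^esup> u\<^sup>2\<close> of them, with \<open>u\<close> the number of units, while \<open>T\<close> has \<open>q\<^sup>r u\<^sup>2\<close> elements.
  The quotient is \<open>q\<^bsup>r-1\<^esup>\<close>.
\<close>

section \<open>The character of an induced representation\<close>

lemma sum_fun_apply: "(\<Sum>i\<in>I. f i) x = (\<Sum>i\<in>I. f i x)"
  for f :: "'i \<Rightarrow> 'x \<Rightarrow> complex"
  by (induction I rule: infinite_finite_induct) auto

text \<open>
  A function in the induced space is determined by its values at representatives of the right
  cosets of \<open>H\<close>, so the functions \<open>e C\<close> that are supported on one coset and equal \<open>1\<close> at its
  representative form a basis. The diagonal coefficient at \<open>e C\<close> is the value at \<open>rep C\<close> of the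
  translate of \<open>e C\<close> by \<open>g\<close>. The formula sums over all of \<open>G\<close>, with the
  factor \<open>card H\<close> on the left, so that later arguments need no representatives.
\<close>

lemma ind_character_frobenius:
  fixes G (structure) and \<chi> :: "'g \<Rightarrow> complex"
  assumes "group G" and fin: "finite (carrier G)" and "subgroup H G"
    and mult: "\<And>h k. h \<in> H \<Longrightarrow> k \<in> H \<Longrightarrow> \<chi> (h \<otimes> k) = \<chi> h * \<chi> k"
    and one: "\<chi> \<one> = 1"
    and g: "g \<in> carrier G"
  shows "of_nat (card H) * ind_character G H \<chi> g =
    (\<Sum>x\<in>carrier G. if x \<otimes> g \<otimes> inv x \<in> H then \<chi> (x \<otimes> g \<otimes> inv x) else 0)"
proof -
  interpret G: group G by fact
  interpret H: subgroup H G by fact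
  define V where "V = ind_space G H \<chi>"
  define rep where "rep = (\<lambda>C :: 'g set. SOME x. x \<in> C)"
  define e where "e = (\<lambda>C y. if y \<in> C then \<chi> (y \<otimes> inv (rep C)) else 0)"
  define \<phi> where "\<phi> = (\<lambda>x. if x \<otimes> g \<otimes> inv x \<in> H then \<chi> (x \<otimes> g \<otimes> inv x) else 0)"
  have finC: "finite (rcosets H)"
    using fin G.rcosets_part_G[OF H.subgroup_axioms] by (metis finite_UnionD)
  have rep_in: "rep C \<in> C" if "C \<in> rcosets H" for C
    unfolding rep_def using H.rcosets_non_empty[OF that] by (simp add: some_in_eq)
  have rep_carrier: "rep C \<in> carrier G" if "C \<in> rcosets H" for C
    using rep_in[OF that] H.rcosets_carrier[OF G.is_group that] by blast
  have C_eq: "C = H #> rep C" if C: "C \<in> rcosets H" for C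
  proof -
    obtain x where x: "x \<in> carrier G" "C = H #> x"
      using C unfolding RCOSETS_def by blast
    show ?thesis using G.repr_independence[OF _ x(1) H.subgroup_axioms] rep_in[OF C] x(2) by simp
  qed
  have in_C: "y \<in> C \<longleftrightarrow> y \<otimes> inv (rep C) \<in> H" if "C \<in> rcosets H" "y \<in> carrier G" for C y
    using H.rcos_module[OF G.is_group rep_carrier[OF that(1)] that(2)] C_eq[OF that(1)] by simp
  have C_sub: "C \<subseteq> carrier G" if "C \<in> rcosets H" for C
    using H.rcosets_carrier[OF G.is_group that] .
  have eV: "e C \<in> V" if C: "C \<in> rcosets H" for C
  proof -
    have "e C (h \<otimes> x) = \<chi> h * e C x" if h: "h \<in> H" and x: "x \<in> carrier G" for h x
    proof -
      have hG: "h \<in> carrier G" using h by (rule H.mem_carrier)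
      have eq: "h \<otimes> x \<otimes> inv (rep C) = h \<otimes> (x \<otimes> inv (rep C))"
        using hG x rep_carrier[OF C] by (simp add: G.m_assoc)
      have "h \<otimes> x \<in> C \<longleftrightarrow> x \<in> C"
      proof -
        have "x \<otimes> inv (rep C) \<in> H" if "h \<otimes> (x \<otimes> inv (rep C)) \<in> H"
        proof -
          have "inv h \<otimes> (h \<otimes> (x \<otimes> inv (rep C))) \<in> H" using that h by simp
          then show ?thesis using hG x rep_carrier[OF C] by (simp add: G.m_assoc[symmetric])
        qed
        moreover have "h \<otimes> x \<in> C \<longleftrightarrow> h \<otimes> (x \<otimes> inv (rep C)) \<in> H"
          using in_C[OF C G.m_closed[OF hG x]] unfolding eq .
        ultimately show ?thesis using in_C[OF C x] h by (meson H.m_closed)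
      qed
      then show ?thesis unfolding e_def using in_C[OF C x] h by (simp add: eq mult)
    qed
    then show ?thesis using C_sub[OF C] unfolding V_def ind_space_def e_def by auto
  qed
  have e_rep: "e C (rep D) = (if C = D then 1 else 0)"
    if "C \<in> rcosets H" "D \<in> rcosets H" for C D
  proof (cases "C = D")
    case True
    then show ?thesis using that rep_in rep_carrier unfolding e_def by (simp add: one)
  next
    case False
    then have "rep D \<notin> C"
      using G.rcos_disjoint[OF H.subgroup_axioms] that rep_in[OF that(2)]
      unfolding pairwise_def disjnt_def by blast
    then show ?thesis using False unfolding e_def by simp
  qed
  have V_scale: "f (h \<otimes> x) = \<chi> h * f x" if "f \<in> V" "h \<in> H" "x \<in> carrier G" for f h x
    using that unfolding V_def ind_space_def by blast
  have inj: "inj_on e (rcosets H)"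
    by (rule inj_onI) (metis e_rep zero_neq_one)
  define B where "B = e ` (rcosets H)"
  have finB: "finite B" unfolding B_def using finC by simp
  have BV: "B \<subseteq> V" unfolding B_def using eV by blast
  have expand: "f = (\<Sum>C\<in>rcosets H. (\<lambda>x. f (rep C) * e C x))" if f: "f \<in> V" for f
  proof
    fix y
    show "f y = (\<Sum>C\<in>rcosets H. (\<lambda>x. f (rep C) * e C x)) y"
    proof (cases "y \<in> carrier G")
      case True
      obtain D where D: "D \<in> rcosets H" "y \<in> D"
        using True G.rcosets_part_G[OF H.subgroup_axioms] by blast
      have "(\<Sum>C\<in>rcosets H. (\<lambda>x. f (rep C) * e C x)) y = (\<Sum>C\<in>rcosets H. f (rep C) * e C y)"
        by (simp add: sum_fun_apply)
      also have "\<dots> = (\<Sum>C\<in>rcosets H. if C = D then f (rep D) * e D y else 0)"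
      proof (rule sum.cong[OF refl])
        fix C assume C: "C \<in> rcosets H"
        have "y \<notin> C" if "C \<noteq> D"
          using G.rcos_disjoint[OF H.subgroup_axioms] that D C
          unfolding pairwise_def disjnt_def by blast
        then show "f (rep C) * e C y = (if C = D then f (rep D) * e D y else 0)"
          unfolding e_def by auto
      qed
      also have "\<dots> = f (rep D) * e D y" using finC D(1) by simp
      also have "\<dots> = f y"
        using V_scale[OF f, of "y \<otimes> inv (rep D)" "rep D"] in_C[OF D(1) True] D True
          rep_carrier[OF D(1)] by (simp add: e_def G.m_assoc)
      finally show ?thesis by simp
    next
      case False
      then have "y \<notin> C" if "C \<in> rcosets H" for C using C_sub that by blast
      then have "(\<Sum>C\<in>rcosets H. (\<lambda>x. f (rep C) * e C x)) y = 0"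
        by (simp add: sum_fun_apply e_def)
      then show ?thesis using f False unfolding V_def ind_space_def by simp
    qed
  qed
  have VB: "V \<subseteq> cfun.span B"
  proof
    fix f assume f: "f \<in> V"
    have "(\<Sum>C\<in>rcosets H. (\<lambda>x. f (rep C) * e C x)) \<in> cfun.span B"
      by (intro cfun.span_sum cfun.span_scale cfun.span_base) (auto simp: B_def)
    then show "f \<in> cfun.span B" using expand[OF f] by simp
  qed
  \<comment> \<open>Evaluation at a representative reads off one coordinate; independence and the trace follow.\<close>
  have coeff: "(\<Sum>b\<in>B. (\<lambda>x. u b * b x)) (rep C) = u (e C)" if C: "C \<in> rcosets H" for u C
  proof -
    have "(\<Sum>b\<in>B. (\<lambda>x. u b * b x)) (rep C) = (\<Sum>D\<in>rcosets H. u (e D) * e D (rep C))"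
      unfolding B_def by (simp add: sum_fun_apply sum.reindex[OF inj])
    also have "\<dots> = (\<Sum>D\<in>rcosets H. if D = C then u (e D) else 0)"
      by (rule sum.cong[OF refl]) (simp add: e_rep C)
    finally show ?thesis using finC C by simp
  qed
  have indep: "cfun.independent B"
  proof
    assume "cfun.dependent B"
    then obtain u b where u: "b \<in> B" "u b \<noteq> 0" "(\<Sum>b\<in>B. (\<lambda>x. u b * b x)) = 0"
      using cfun.dependent_finite[OF finB] by blast
    then obtain C where "C \<in> rcosets H" "b = e C" unfolding B_def by blast
    then show False using coeff[of C u] u by simp
  qed
  let ?A = "ind_action G g"
  have lin: "Vector_Spaces.linear (\<lambda>(c::complex) (f :: 'g \<Rightarrow> complex) x. c * f x)
      (\<lambda>(c::complex) (f :: 'g \<Rightarrow> complex) x. c * f x) ?A"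
    by unfold_locales (auto simp: fun_eq_iff ind_action_def algebra_simps)
  have stable: "?A f \<in> V" if "f \<in> V" for f
    using that g unfolding V_def ind_space_def ind_action_def
    by (auto simp: G.m_assoc H.mem_carrier)
  \<comment> \<open>The basis that the definition of the trace happens to choose; it must be finite to be comparable with \<open>B\<close>.\<close>
  define B' where "B' = (SOME B. B \<subseteq> V \<and> cfun.independent B \<and> V \<subseteq> cfun.span B)"
  have B': "B' \<subseteq> V" "cfun.independent B'" "V \<subseteq> cfun.span B'"
    using someI[of "\<lambda>B. B \<subseteq> V \<and> cfun.independent B \<and> V \<subseteq> cfun.span B",
        folded B'_def, OF conjI[OF BV conjI[OF indep VB]]]
    by auto
  have finB': "finite B'"
    using cfun.independent_span_bound[OF finB B'(2)] B'(1) VB by blast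
  have "ind_character G H \<chi> g = (\<Sum>b\<in>B'. cfun.representation B' (?A b) b)"
    unfolding ind_character_def trace_on_def V_def[symmetric] B'_def Let_def ..
  also have "\<dots> = (\<Sum>b\<in>B. cfun.representation B (?A b) b)"
    by (rule trace_basis_independent[OF lin stable finB' B' finB BV indep VB])
  also have "\<dots> = (\<Sum>C\<in>rcosets H. \<phi> (rep C))"
    unfolding B_def sum.reindex[OF inj] comp_def
  proof (rule sum.cong[OF refl])
    fix C assume C: "C \<in> rcosets H"
    have "?A (e C) \<in> cfun.span B" using stable[OF eV[OF C]] VB by blast
    then have "?A (e C) = (\<Sum>b\<in>B. (\<lambda>x. cfun.representation B (?A (e C)) b * b x))"
      using cfun.sum_representation_eq[OF indep _ finB order_refl] by simp
    then have "?A (e C) (rep C) =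
        (\<Sum>b\<in>B. (\<lambda>x. cfun.representation B (?A (e C)) b * b x)) (rep C)"
      by (rule fun_cong)
    then have "cfun.representation B (?A (e C)) (e C) = ?A (e C) (rep C)"
      unfolding coeff[OF C] ..
    also have "\<dots> = \<phi> (rep C)"
      using in_C[OF C, of "rep C \<otimes> g"] rep_carrier[OF C] g
      by (simp add: ind_action_def e_def \<phi>_def)
    finally show "cfun.representation (e ` (rcosets H)) (?A (e C)) (e C) = \<phi> (rep C)"
      by (simp add: B_def)
  qed
  finally have trace: "ind_character G H \<chi> g = (\<Sum>C\<in>rcosets H. \<phi> (rep C))" .
  \<comment> \<open>\<open>\<phi>\<close> is a function of the coset, so each coset contributes \<open>card H\<close> equal terms.\<close>
  have \<phi>_const: "\<phi> (h \<otimes> x) = \<phi> x" if h: "h \<in> H" and x: "x \<in> carrier G" for h x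
  proof -
    define k where "k = x \<otimes> g \<otimes> inv x"
    have hG: "h \<in> carrier G" and kG: "k \<in> carrier G"
      unfolding k_def using h x g by auto
    have eq: "h \<otimes> x \<otimes> g \<otimes> inv (h \<otimes> x) = h \<otimes> k \<otimes> inv h"
      unfolding k_def using hG x g by (simp add: G.m_assoc G.inv_mult_group)
    have "inv h \<otimes> (h \<otimes> (k \<otimes> inv h)) = k \<otimes> inv h"
      using hG kG by (simp add: G.m_assoc[symmetric])
    then have cancel: "inv h \<otimes> (h \<otimes> k \<otimes> inv h) \<otimes> h = k"
      using hG kG by (simp add: G.m_assoc)
    have "h \<otimes> k \<otimes> inv h \<in> H \<longleftrightarrow> k \<in> H"
    proof
      assume "h \<otimes> k \<otimes> inv h \<in> H"
      then have "inv h \<otimes> (h \<otimes> k \<otimes> inv h) \<otimes> h \<in> H" using h by simp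
      then show "k \<in> H" by (simp only: cancel)
    qed (use h in simp)
    moreover have "\<chi> (h \<otimes> k \<otimes> inv h) = \<chi> k" if "k \<in> H"
    proof -
      have "\<chi> (h \<otimes> k \<otimes> inv h) = \<chi> k * (\<chi> h * \<chi> (inv h))" using h that by (simp add: mult)
      also have "\<chi> h * \<chi> (inv h) = 1" using h mult[of h "inv h"] hG by (simp add: one)
      finally show ?thesis by simp
    qed
    ultimately show ?thesis unfolding \<phi>_def eq using k_def by auto
  qed
  have "(\<Sum>x\<in>carrier G. \<phi> x) = (\<Sum>x\<in>\<Union>(rcosets H). \<phi> x)"
    using G.rcosets_part_G[OF H.subgroup_axioms] by simp
  also have "\<dots> = (\<Sum>C\<in>rcosets H. \<Sum>x\<in>C. \<phi> x)"
    using G.rcos_disjoint[OF H.subgroup_axioms] finite_subset[OF C_sub fin]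
    by (subst sum.Union_disjoint) (auto simp: pairwise_def disjnt_def)
  also have "\<dots> = (\<Sum>C\<in>rcosets H. of_nat (card H) * \<phi> (rep C))"
  proof (rule sum.cong[OF refl])
    fix C assume C: "C \<in> rcosets H"
    have "\<phi> x = \<phi> (rep C)" if x: "x \<in> C" for x
    proof -
      have "x \<in> H #> rep C" using x C_eq[OF C] by simp
      then obtain h where "h \<in> H" "x = h \<otimes> rep C" unfolding r_coset_def by blast
      then show ?thesis using \<phi>_const rep_carrier[OF C] by simp
    qed
    then have "(\<Sum>x\<in>C. \<phi> x) = of_nat (card C) * \<phi> (rep C)" by simp
    then show "(\<Sum>x\<in>C. \<phi> x) = of_nat (card H) * \<phi> (rep C)"
      using G.card_rcosets_equal[OF C H.subset] by simp
  qed
  finally show ?thesis unfolding trace sum_distrib_left \<phi>_def by simp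
qed

section \<open>Two by two matrices over a commutative ring\<close>

context cring begin

lemma mat2_carrier_iff:
  "Mat2 a b c d \<in> carrier (mat2_monoid R) \<longleftrightarrow>
    a \<in> carrier R \<and> b \<in> carrier R \<and> c \<in> carrier R \<and> d \<in> carrier R"
  by (auto simp: mat2_monoid_def)

lemma mat2_mult:
  "Mat2 a b c d \<otimes>\<^bsub>mat2_monoid R\<^esub> Mat2 a' b' c' d' =
    Mat2 (a \<otimes> a' \<oplus> b \<otimes> c') (a \<otimes> b' \<oplus> b \<otimes> d') (c \<otimes> a' \<oplus> d \<otimes> c') (c \<otimes> b' \<oplus> d \<otimes> d')"
  by (simp add: mat2_monoid_def)

lemma mat2_one: "\<one>\<^bsub>mat2_monoid R\<^esub> = Mat2 \<one> \<zero> \<zero> \<one>"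
  by (simp add: mat2_monoid_def)

lemma mat2_monoid: "monoid (mat2_monoid R)"
proof
  fix x y z assume "x \<in> carrier (mat2_monoid R)" "y \<in> carrier (mat2_monoid R)" "z \<in> carrier (mat2_monoid R)"
  then show "x \<otimes>\<^bsub>mat2_monoid R\<^esub> y \<otimes>\<^bsub>mat2_monoid R\<^esub> z = x \<otimes>\<^bsub>mat2_monoid R\<^esub> (y \<otimes>\<^bsub>mat2_monoid R\<^esub> z)"
    by (cases x; cases y; cases z) (simp add: mat2_mult mat2_carrier_iff, algebra)
next
  fix x y assume "x \<in> carrier (mat2_monoid R)" "y \<in> carrier (mat2_monoid R)"
  then show "x \<otimes>\<^bsub>mat2_monoid R\<^esub> y \<in> carrier (mat2_monoid R)"
    by (cases x; cases y) (simp add: mat2_mult mat2_carrier_iff)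
next
  show "\<one>\<^bsub>mat2_monoid R\<^esub> \<in> carrier (mat2_monoid R)"
    by (simp add: mat2_one mat2_carrier_iff)
next
  fix x assume "x \<in> carrier (mat2_monoid R)"
  then show "\<one>\<^bsub>mat2_monoid R\<^esub> \<otimes>\<^bsub>mat2_monoid R\<^esub> x = x" "x \<otimes>\<^bsub>mat2_monoid R\<^esub> \<one>\<^bsub>mat2_monoid R\<^esub> = x"
    by (cases x; simp add: mat2_one mat2_mult mat2_carrier_iff)+
qed

lemma Mat2_in_GL2_iff:
  "Mat2 a b c d \<in> carrier (GL2 R) \<longleftrightarrow>
    a \<in> carrier R \<and> b \<in> carrier R \<and> c \<in> carrier R \<and> d \<in> carrier R \<and>
    a \<otimes> d \<ominus> b \<otimes> c \<in> Units R"
proof -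
  interpret M: monoid "mat2_monoid R" by (rule mat2_monoid)
  have "Mat2 a b c d \<in> Units (mat2_monoid R)"
    if c: "a \<in> carrier R" "b \<in> carrier R" "c \<in> carrier R" "d \<in> carrier R"
      and u: "a \<otimes> d \<ominus> b \<otimes> c \<in> Units R"
  proof -
    define \<delta> where "\<delta> = inv (a \<otimes> d \<ominus> b \<otimes> c)"
    have \<delta>: "\<delta> \<in> carrier R" "\<delta> \<otimes> (a \<otimes> d \<ominus> b \<otimes> c) = \<one>" using u by (simp_all add: \<delta>_def)
    let ?N = "Mat2 (\<delta> \<otimes> d) (\<delta> \<otimes> (\<ominus> b)) (\<delta> \<otimes> (\<ominus> c)) (\<delta> \<otimes> a)"
    have 1: "a \<otimes> (\<delta> \<otimes> d) \<oplus> b \<otimes> (\<delta> \<otimes> \<ominus> c) = \<one>" "\<delta> \<otimes> d \<otimes> a \<oplus> \<delta> \<otimes> (\<ominus> b) \<otimes> c = \<one>"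
      "c \<otimes> (\<delta> \<otimes> \<ominus> b) \<oplus> d \<otimes> (\<delta> \<otimes> a) = \<one>" "\<delta> \<otimes> (\<ominus> c) \<otimes> b \<oplus> \<delta> \<otimes> a \<otimes> d = \<one>"
      unfolding \<delta>(2)[symmetric] using c \<delta>(1) by algebra+
    have 2: "a \<otimes> (\<delta> \<otimes> \<ominus> b) \<oplus> b \<otimes> (\<delta> \<otimes> a) = \<zero>" "\<delta> \<otimes> d \<otimes> b \<oplus> \<delta> \<otimes> (\<ominus> b) \<otimes> d = \<zero>"
      "c \<otimes> (\<delta> \<otimes> d) \<oplus> d \<otimes> (\<delta> \<otimes> \<ominus> c) = \<zero>" "\<delta> \<otimes> (\<ominus> c) \<otimes> a \<oplus> \<delta> \<otimes> a \<otimes> c = \<zero>"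
      using c \<delta>(1) by algebra+
    have "Mat2 a b c d \<otimes>\<^bsub>mat2_monoid R\<^esub> ?N = \<one>\<^bsub>mat2_monoid R\<^esub>"
      "?N \<otimes>\<^bsub>mat2_monoid R\<^esub> Mat2 a b c d = \<one>\<^bsub>mat2_monoid R\<^esub>"
      by (simp_all only: mat2_mult mat2_one 1 2)
    moreover have "?N \<in> carrier (mat2_monoid R)" "Mat2 a b c d \<in> carrier (mat2_monoid R)"
      using c \<delta> by (simp_all add: mat2_carrier_iff)
    ultimately show ?thesis unfolding Units_def by blast
  qed
  moreover have "a \<in> carrier R \<and> b \<in> carrier R \<and> c \<in> carrier R \<and> d \<in> carrier R \<and>
    a \<otimes> d \<ominus> b \<otimes> c \<in> Units R" if unit: "Mat2 a b c d \<in> Units (mat2_monoid R)"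
  proof -
    have "Mat2 a b c d \<in> carrier (mat2_monoid R)" using that by blast
    then have c: "a \<in> carrier R" "b \<in> carrier R" "c \<in> carrier R" "d \<in> carrier R"
      by (simp_all add: mat2_carrier_iff)
    obtain N where N: "N \<in> carrier (mat2_monoid R)" "Mat2 a b c d \<otimes>\<^bsub>mat2_monoid R\<^esub> N = \<one>\<^bsub>mat2_monoid R\<^esub>"
      using M.Units_r_inv_ex[OF unit] by blast
    obtain a' b' c' d' where N_eq: "N = Mat2 a' b' c' d'" by (cases N)
    have c': "a' \<in> carrier R" "b' \<in> carrier R" "c' \<in> carrier R" "d' \<in> carrier R"
      using N(1) by (simp_all add: N_eq mat2_carrier_iff)
    have "(a \<otimes> d \<ominus> b \<otimes> c) \<otimes> (a' \<otimes> d' \<ominus> b' \<otimes> c') = (a \<otimes> a' \<oplus> b \<otimes> c') \<otimes> (c \<otimes> b' \<oplus> d \<otimes> d') \<ominus> (a \<otimes> b' \<oplus> b \<otimes> d') \<otimes> (c \<otimes> a' \<oplus> d \<otimes> c')"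
      using c c' by algebra
    also have "\<dots> = \<one> \<otimes> \<one> \<ominus> \<zero> \<otimes> \<zero>"
      using N(2) by (simp add: N_eq mat2_mult mat2_one)
    also have "\<dots> = \<one>" by algebra
    finally have "(a \<otimes> d \<ominus> b \<otimes> c) \<otimes> (a' \<otimes> d' \<ominus> b' \<otimes> c') = \<one>" .
    moreover from this have "(a' \<otimes> d' \<ominus> b' \<otimes> c') \<otimes> (a \<otimes> d \<ominus> b \<otimes> c) = \<one>"
      using c c' by (simp add: m_comm)
    moreover have "a \<otimes> d \<ominus> b \<otimes> c \<in> carrier R" "a' \<otimes> d' \<ominus> b' \<otimes> c' \<in> carrier R"
      using c c' by simp_all
    ultimately have "a \<otimes> d \<ominus> b \<otimes> c \<in> Units R" unfolding Units_def by blast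
    with c show ?thesis by simp
  qed
  ultimately show ?thesis unfolding GL2_def units_of_carrier by blast
qed

lemma GL2_group: "group (GL2 R)"
  unfolding GL2_def by (rule monoid.units_group[OF mat2_monoid])

lemma GL2_mult: "(\<otimes>\<^bsub>GL2 R\<^esub>) = (\<otimes>\<^bsub>mat2_monoid R\<^esub>)"
  by (simp add: GL2_def units_of_mult)

lemma GL2_one: "\<one>\<^bsub>GL2 R\<^esub> = Mat2 \<one> \<zero> \<zero> \<one>"
  by (simp add: GL2_def units_of_one mat2_one)

lemma finite_GL2: "finite (carrier R) \<Longrightarrow> finite (carrier (GL2 R))"
proof (rule finite_subset)
  show "carrier (GL2 R) \<subseteq> (\<lambda>(a, b, c, d). Mat2 a b c d) `
      (carrier R \<times> carrier R \<times> carrier R \<times> carrier R)"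
  proof
    fix x assume "x \<in> carrier (GL2 R)"
    then show "x \<in> (\<lambda>(a, b, c, d). Mat2 a b c d) ` (carrier R \<times> carrier R \<times> carrier R \<times> carrier R)"
      by (cases x) (force simp: Mat2_in_GL2_iff)
  qed
qed auto

text \<open>
  The hypothesis is a polynomial identity between entries, so a conjugate by \<open>x\<close> can be certified without
  the entries of \<open>x\<inverse>\<close>.
\<close>

lemma GL2_conj_eqI:
  assumes x: "x \<in> carrier (GL2 R)" and B: "B \<in> carrier (GL2 R)"
    and h: "h \<in> carrier (mat2_monoid R)"
    and eq: "h \<otimes>\<^bsub>mat2_monoid R\<^esub> x = x \<otimes>\<^bsub>mat2_monoid R\<^esub> B"
  shows "x \<otimes>\<^bsub>GL2 R\<^esub> B \<otimes>\<^bsub>GL2 R\<^esub> inv\<^bsub>GL2 R\<^esub> x = h"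
proof -
  interpret M: monoid "mat2_monoid R" by (rule mat2_monoid)
  have U: "x \<in> Units (mat2_monoid R)" using x by (simp add: GL2_def units_of_carrier)
  have "x \<otimes>\<^bsub>GL2 R\<^esub> B \<otimes>\<^bsub>GL2 R\<^esub> inv\<^bsub>GL2 R\<^esub> x =
      h \<otimes>\<^bsub>mat2_monoid R\<^esub> x \<otimes>\<^bsub>mat2_monoid R\<^esub> inv\<^bsub>mat2_monoid R\<^esub> x"
    using M.units_of_inv[OF U] by (simp add: eq GL2_def units_of_mult)
  also have "\<dots> = h" using U h by (simp add: M.m_assoc M.Units_closed)
  finally show ?thesis .
qed

text \<open>
  The entries of \<open>x N x\<inverse>\<close>, where \<open>x\<close> has rows \<open>(a, b)\<close>, \<open>(c, d)\<close> and \<open>N\<close> has rows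
  \<open>(0, e)\<close>, \<open>(1, 0)\<close>. The fourth entry is the negative of the first, since \<open>N\<close> has trace zero.
\<close>

definition conj11 :: "'a \<Rightarrow> 'a \<Rightarrow> 'a \<Rightarrow> 'a \<Rightarrow> 'a \<Rightarrow> 'a" where
  "conj11 e a b c d = inv (a \<otimes> d \<ominus> b \<otimes> c) \<otimes> (b \<otimes> d \<ominus> e \<otimes> a \<otimes> c)"

definition conj12 :: "'a \<Rightarrow> 'a \<Rightarrow> 'a \<Rightarrow> 'a \<Rightarrow> 'a \<Rightarrow> 'a" where
  "conj12 e a b c d = inv (a \<otimes> d \<ominus> b \<otimes> c) \<otimes> (e \<otimes> a \<otimes> a \<ominus> b \<otimes> b)"

definition conj21 :: "'a \<Rightarrow> 'a \<Rightarrow> 'a \<Rightarrow> 'a \<Rightarrow> 'a \<Rightarrow> 'a" where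
  "conj21 e a b c d = inv (a \<otimes> d \<ominus> b \<otimes> c) \<otimes> (d \<otimes> d \<ominus> e \<otimes> c \<otimes> c)"

lemma conj_closed:
  assumes "Mat2 a b c d \<in> carrier (GL2 R)" "e \<in> carrier R"
  shows "conj11 e a b c d \<in> carrier R" "conj12 e a b c d \<in> carrier R" "conj21 e a b c d \<in> carrier R"
  using assms by (simp_all add: Mat2_in_GL2_iff conj11_def conj12_def conj21_def)

lemma GL2_conj:
  assumes x: "Mat2 a b c d \<in> carrier (GL2 R)"
    and \<alpha>: "\<alpha> \<in> carrier R" and n: "n \<in> carrier R" and e: "e \<in> carrier R"
    and B: "Mat2 \<alpha> (n \<otimes> e) n \<alpha> \<in> carrier (GL2 R)"
  shows "Mat2 a b c d \<otimes>\<^bsub>GL2 R\<^esub> Mat2 \<alpha> (n \<otimes> e) n \<alpha> \<otimes>\<^bsub>GL2 R\<^esub> inv\<^bsub>GL2 R\<^esub> Mat2 a b c d =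
    Mat2 (\<alpha> \<oplus> n \<otimes> conj11 e a b c d) (n \<otimes> conj12 e a b c d)
      (n \<otimes> conj21 e a b c d) (\<alpha> \<ominus> n \<otimes> conj11 e a b c d)"
proof (rule GL2_conj_eqI[OF x B])
  define \<delta> where "\<delta> = inv (a \<otimes> d \<ominus> b \<otimes> c)"
  let ?P = "\<delta> \<otimes> (b \<otimes> d \<ominus> e \<otimes> a \<otimes> c)" and ?Q = "\<delta> \<otimes> (e \<otimes> a \<otimes> a \<ominus> b \<otimes> b)"
    and ?S = "\<delta> \<otimes> (d \<otimes> d \<ominus> e \<otimes> c \<otimes> c)"
  have c: "a \<in> carrier R" "b \<in> carrier R" "c \<in> carrier R" "d \<in> carrier R"
    and u: "a \<otimes> d \<ominus> b \<otimes> c \<in> Units R"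
    using x by (simp_all add: Mat2_in_GL2_iff)
  have \<delta>: "\<delta> \<in> carrier R" "\<delta> \<otimes> (a \<otimes> d \<ominus> b \<otimes> c) = \<one>" using u by (simp_all add: \<delta>_def)
  note entries = conj11_def conj12_def conj21_def \<delta>_def[symmetric]
  show "Mat2 (\<alpha> \<oplus> n \<otimes> conj11 e a b c d) (n \<otimes> conj12 e a b c d)
      (n \<otimes> conj21 e a b c d) (\<alpha> \<ominus> n \<otimes> conj11 e a b c d) \<in> carrier (mat2_monoid R)"
    using conj_closed[OF x e] \<alpha> n by (simp add: mat2_carrier_iff)
  have "(\<alpha> \<oplus> n \<otimes> ?P) \<otimes> a \<oplus> n \<otimes> ?Q \<otimes> c = a \<otimes> \<alpha> \<oplus> (\<delta> \<otimes> (a \<otimes> d \<ominus> b \<otimes> c)) \<otimes> (b \<otimes> n)"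
    "(\<alpha> \<oplus> n \<otimes> ?P) \<otimes> b \<oplus> n \<otimes> ?Q \<otimes> d = (\<delta> \<otimes> (a \<otimes> d \<ominus> b \<otimes> c)) \<otimes> (a \<otimes> (n \<otimes> e)) \<oplus> b \<otimes> \<alpha>"
    "n \<otimes> ?S \<otimes> a \<oplus> (\<alpha> \<ominus> n \<otimes> ?P) \<otimes> c = c \<otimes> \<alpha> \<oplus> (\<delta> \<otimes> (a \<otimes> d \<ominus> b \<otimes> c)) \<otimes> (d \<otimes> n)"
    "n \<otimes> ?S \<otimes> b \<oplus> (\<alpha> \<ominus> n \<otimes> ?P) \<otimes> d = (\<delta> \<otimes> (a \<otimes> d \<ominus> b \<otimes> c)) \<otimes> (c \<otimes> (n \<otimes> e)) \<oplus> d \<otimes> \<alpha>"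
    using c \<delta>(1) \<alpha> n e by algebra+
  then show "Mat2 (\<alpha> \<oplus> n \<otimes> conj11 e a b c d) (n \<otimes> conj12 e a b c d)
      (n \<otimes> conj21 e a b c d) (\<alpha> \<ominus> n \<otimes> conj11 e a b c d) \<otimes>\<^bsub>mat2_monoid R\<^esub> Mat2 a b c d =
    Mat2 a b c d \<otimes>\<^bsub>mat2_monoid R\<^esub> Mat2 \<alpha> (n \<otimes> e) n \<alpha>"
    using c \<alpha> n e by (simp add: mat2_mult \<delta>(2) entries)
qed

text \<open>
  Left multiplication by the unipotent matrices with rows \<open>(1, s)\<close>, \<open>(0, 1)\<close> and
  \<open>(1, 0)\<close>, \<open>(s, 1)\<close>.
\<close>

definition upper_shear :: "'a \<Rightarrow> 'a mat2 \<Rightarrow> 'a mat2" where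
  "upper_shear s x = Mat2 (ent11 x \<oplus> s \<otimes> ent21 x) (ent12 x \<oplus> s \<otimes> ent22 x) (ent21 x) (ent22 x)"

definition lower_shear :: "'a \<Rightarrow> 'a mat2 \<Rightarrow> 'a mat2" where
  "lower_shear s x = Mat2 (ent11 x) (ent12 x) (ent21 x \<oplus> s \<otimes> ent11 x) (ent22 x \<oplus> s \<otimes> ent12 x)"

lemma inj_on_shear:
  assumes s: "s \<in> carrier R"
  shows "inj_on (upper_shear s) (carrier (GL2 R))" "inj_on (lower_shear s) (carrier (GL2 R))"
proof -
  have "x = y" if xy: "x \<in> carrier (GL2 R)" "y \<in> carrier (GL2 R)"
    and eq: "upper_shear s x = upper_shear s y \<or> lower_shear s x = lower_shear s y" for x y
  proof -
    obtain a b c d where x: "x = Mat2 a b c d" by (cases x)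
    obtain a' b' c' d' where y: "y = Mat2 a' b' c' d'" by (cases y)
    have c: "a \<in> carrier R" "b \<in> carrier R" "c \<in> carrier R" "d \<in> carrier R"
      "a' \<in> carrier R" "b' \<in> carrier R" "c' \<in> carrier R" "d' \<in> carrier R"
      using xy by (simp_all add: x y Mat2_in_GL2_iff)
    show ?thesis using eq c s by (auto simp: x y upper_shear_def lower_shear_def)
  qed
  then show "inj_on (upper_shear s) (carrier (GL2 R))" "inj_on (lower_shear s) (carrier (GL2 R))"
    by (auto intro!: inj_onI)
qed

lemma GL2_upper_shear:
  assumes x: "Mat2 a b c d \<in> carrier (GL2 R)" and s: "s \<in> carrier R" and e: "e \<in> carrier R"
  shows "upper_shear s (Mat2 a b c d) \<in> carrier (GL2 R)"
    and "conj11 e (a \<oplus> s \<otimes> c) (b \<oplus> s \<otimes> d) c d = conj11 e a b c d \<oplus> s \<otimes> conj21 e a b c d"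
proof -
  have c: "a \<in> carrier R" "b \<in> carrier R" "c \<in> carrier R" "d \<in> carrier R"
    and u: "a \<otimes> d \<ominus> b \<otimes> c \<in> Units R"
    using x by (simp_all add: Mat2_in_GL2_iff)
  define \<delta> where "\<delta> = inv (a \<otimes> d \<ominus> b \<otimes> c)"
  have \<delta>: "\<delta> \<in> carrier R" using u by (simp add: \<delta>_def)
  have det: "(a \<oplus> s \<otimes> c) \<otimes> d \<ominus> (b \<oplus> s \<otimes> d) \<otimes> c = a \<otimes> d \<ominus> b \<otimes> c"
    using c s by algebra
  show "upper_shear s (Mat2 a b c d) \<in> carrier (GL2 R)"
    using c s u det by (simp add: Mat2_in_GL2_iff upper_shear_def)
  show "conj11 e (a \<oplus> s \<otimes> c) (b \<oplus> s \<otimes> d) c d = conj11 e a b c d \<oplus> s \<otimes> conj21 e a b c d"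
    unfolding conj11_def conj21_def det \<delta>_def[symmetric] using c s e \<delta> by algebra
qed

lemma GL2_lower_shear:
  assumes x: "Mat2 a b c d \<in> carrier (GL2 R)" and s: "s \<in> carrier R" and e: "e \<in> carrier R"
  shows "lower_shear s (Mat2 a b c d) \<in> carrier (GL2 R)"
    and "conj11 e a b (c \<oplus> s \<otimes> a) (d \<oplus> s \<otimes> b) = conj11 e a b c d \<ominus> s \<otimes> conj12 e a b c d"
proof -
  have c: "a \<in> carrier R" "b \<in> carrier R" "c \<in> carrier R" "d \<in> carrier R"
    and u: "a \<otimes> d \<ominus> b \<otimes> c \<in> Units R"
    using x by (simp_all add: Mat2_in_GL2_iff)
  define \<delta> where "\<delta> = inv (a \<otimes> d \<ominus> b \<otimes> c)"
  have \<delta>: "\<delta> \<in> carrier R" using u by (simp add: \<delta>_def)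
  have det: "a \<otimes> (d \<oplus> s \<otimes> b) \<ominus> b \<otimes> (c \<oplus> s \<otimes> a) = a \<otimes> d \<ominus> b \<otimes> c"
    using c s by algebra
  show "lower_shear s (Mat2 a b c d) \<in> carrier (GL2 R)"
    using c s u det by (simp add: Mat2_in_GL2_iff lower_shear_def)
  show "conj11 e a b (c \<oplus> s \<otimes> a) (d \<oplus> s \<otimes> b) = conj11 e a b c d \<ominus> s \<otimes> conj12 e a b c d"
    unfolding conj11_def conj12_def det \<delta>_def[symmetric] using c s e \<delta> by algebra
qed

end

section \<open>Truncated discrete valuation rings\<close>

text \<open>
  What the proof needs to know about \<open>\<O> / \<varpi>\<^sup>r\<close>: it is local with principal maximal ideal
  generated by \<open>t\<close>, the nilpotency index of \<open>t\<close> is exactly \<open>r\<close>, and there is a system of \<open>q\<close>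
  representatives modulo \<open>t\<close>. Representatives, rather than the residue field itself, give
  both finiteness and cardinalities through digit expansions.
\<close>

locale truncated_dvr = cring R for R (structure) +
  fixes t :: 'a and r q :: nat
  assumes t_closed [simp]: "t \<in> carrier R"
    and t_pow_r: "t [^] r = \<zero>"
    and t_pow_pred_r: "t [^] (r - 1) \<noteq> \<zero>"
    and nonunit_iff: "x \<in> carrier R \<Longrightarrow> x \<notin> Units R \<longleftrightarrow> (\<exists>y\<in>carrier R. x = t \<otimes> y)"
    and residue_system: "\<exists>C\<subseteq>carrier R. finite C \<and> card C = q \<and>
      (\<forall>x\<in>carrier R. \<exists>c\<in>C. \<exists>y\<in>carrier R. x = c \<oplus> t \<otimes> y) \<and>
      (\<forall>c\<in>C. \<forall>c'\<in>C. \<forall>y\<in>carrier R. c = c' \<oplus> t \<otimes> y \<longrightarrow> c = c')"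
begin

definition level :: "nat \<Rightarrow> 'a set" where
  "level k = (\<lambda>y. t [^] k \<otimes> y) ` carrier R"

lemma r_pos: "0 < r"
  using t_pow_r t_pow_pred_r by (cases r) auto

lemma t_pow_nonzero: "j < r \<Longrightarrow> t [^] j \<noteq> \<zero>"
proof
  assume j: "j < r" and "t [^] j = \<zero>"
  then have "t [^] j \<otimes> t [^] (r - 1 - j) = \<zero>" by simp
  then show False using j t_pow_pred_r by (simp add: nat_pow_mult)
qed

lemma t_pow_ge_r: "r \<le> j \<Longrightarrow> t [^] j = \<zero>"
proof -
  assume "r \<le> j"
  then have "t [^] j = t [^] r \<otimes> t [^] (j - r)" by (simp add: nat_pow_mult)
  then show ?thesis by (simp add: t_pow_r)
qed

lemma t_mult_nonunit: "y \<in> carrier R \<Longrightarrow> t \<otimes> y \<notin> Units R"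
  using nonunit_iff[of "t \<otimes> y"] by auto

lemma Units_add_nonunit:
  assumes "u \<in> Units R" "y \<in> carrier R"
  shows "u \<oplus> t \<otimes> y \<in> Units R"
proof (rule ccontr)
  assume "u \<oplus> t \<otimes> y \<notin> Units R"
  then obtain z where z: "z \<in> carrier R" "u \<oplus> t \<otimes> y = t \<otimes> z"
    using nonunit_iff[of "u \<oplus> t \<otimes> y"] Units_closed[OF assms(1)] assms(2) by auto
  have "u = (u \<oplus> t \<otimes> y) \<ominus> t \<otimes> y" using Units_closed[OF assms(1)] assms(2) t_closed by algebra
  also have "\<dots> = t \<otimes> (z \<ominus> y)" unfolding z(2) using z(1) assms(2) t_closed by algebra
  finally have "u = t \<otimes> (z \<ominus> y)" .
  then show False using t_mult_nonunit[of "z \<ominus> y"] z(1) assms by simp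
qed

lemma Units_uminus:
  assumes u: "u \<in> Units R"
  shows "\<ominus> u \<in> Units R"
proof (rule ccontr)
  have uR: "u \<in> carrier R" using u by (rule Units_closed)
  assume "\<ominus> u \<notin> Units R"
  then obtain y where y: "y \<in> carrier R" "\<ominus> u = t \<otimes> y"
    using nonunit_iff[OF a_inv_closed[OF uR]] by blast
  have "u = \<ominus> (\<ominus> u)" using uR by simp
  also have "\<dots> = t \<otimes> (\<ominus> y)" unfolding y(2) using y(1) by (simp add: r_minus)
  finally show False using t_mult_nonunit[of "\<ominus> y"] y(1) u by simp
qed

lemma Units_mult_iff:
  assumes "x \<in> carrier R" "y \<in> carrier R"
  shows "x \<otimes> y \<in> Units R \<longleftrightarrow> x \<in> Units R \<and> y \<in> Units R"
proof -
  have "x \<in> Units R" if xy: "x \<otimes> y \<in> Units R" "x \<in> carrier R" "y \<in> carrier R" for x y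
  proof (rule ccontr)
    assume "x \<notin> Units R"
    then obtain z where z: "z \<in> carrier R" "x = t \<otimes> z"
      using nonunit_iff[OF \<open>x \<in> carrier R\<close>] by blast
    then have "x \<otimes> y = t \<otimes> (z \<otimes> y)" using xy by (simp add: m_assoc)
    then show False using t_mult_nonunit[of "z \<otimes> y"] z xy by simp
  qed
  from this[of x y] this[of y x] show ?thesis using assms by (auto simp: m_comm)
qed

lemma level_subset: "level k \<subseteq> carrier R"
  by (auto simp: level_def)

lemma level_closed: "x \<in> level k \<Longrightarrow> x \<in> carrier R"
  using level_subset by blast

lemma level_mono: "k \<le> j \<Longrightarrow> y \<in> carrier R \<Longrightarrow> t [^] j \<otimes> y \<in> level k"
  unfolding level_def
  by (intro image_eqI[of _ _ "t [^] (j - k) \<otimes> y"])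
     (simp_all add: m_assoc[symmetric] nat_pow_mult)

text \<open>
  Otherwise multiplying by \<open>t\<^bsup>r-k\<^esup>\<close> would give \<open>t\<^bsup>r-k+j\<^esup> = 0\<close> with exponent below \<open>r\<close>.
\<close>

lemma unit_multiple_notin_level:
  assumes "j < k" "k \<le> r" "u \<in> Units R"
  shows "t [^] j \<otimes> u \<notin> level k"
proof
  assume "t [^] j \<otimes> u \<in> level k"
  then obtain y where y: "y \<in> carrier R" "t [^] j \<otimes> u = t [^] k \<otimes> y" unfolding level_def by blast
  have u: "u \<in> carrier R" "u \<otimes> inv u = \<one>" using assms(3) by (auto simp: Units_r_inv)
  have iu: "inv u \<in> carrier R" using assms(3) by simp
  have "t [^] (r - k + j) = t [^] (r - k) \<otimes> (t [^] j \<otimes> u) \<otimes> inv u"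
    using u iu by (simp add: m_assoc nat_pow_mult)
  also have "\<dots> = t [^] (r - k + k) \<otimes> y \<otimes> inv u"
    unfolding y(2) using y iu by (simp add: m_assoc nat_pow_mult[symmetric])
  also have "\<dots> = \<zero>" using assms(2) y iu by (simp add: t_pow_r)
  finally have "t [^] (r - k + j) = \<zero>" .
  moreover have "r - k + j < r" using assms by linarith
  ultimately show False using t_pow_nonzero[of "r - k + j"] by simp
qed

text \<open>
  One step of the digit expansion: an element of \<open>t\<^sup>j R\<close> is uniquely \<open>t\<^sup>j c + y\<close> with \<open>c\<close> a
  representative modulo \<open>t\<close> and \<open>y \<in> t\<^bsup>j+1\<^esup> R\<close>. Uniqueness of the digit holds because for \<open>j < r\<close>
  a unit multiple of \<open>t\<^sup>j\<close> is not divisible by \<open>t\<^bsup>j+1\<^esup>\<close>.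
\<close>

lemma level_card_Suc:
  assumes j: "j < r" and fin: "finite (level (Suc j))"
  shows "finite (level j) \<and> card (level j) = q * card (level (Suc j))"
proof -
  obtain C where C: "C \<subseteq> carrier R" "finite C" "card C = q"
    and covers: "\<forall>x\<in>carrier R. \<exists>c\<in>C. \<exists>y\<in>carrier R. x = c \<oplus> t \<otimes> y"
    and unique: "\<forall>c\<in>C. \<forall>c'\<in>C. \<forall>y\<in>carrier R. c = c' \<oplus> t \<otimes> y \<longrightarrow> c = c'"
    using residue_system by blast
  let ?f = "\<lambda>(c, y). t [^] j \<otimes> c \<oplus> y"
  have "bij_betw ?f (C \<times> level (Suc j)) (level j)"
  proof (rule bij_betw_imageI)
    show "inj_on ?f (C \<times> level (Suc j))"
    proof (rule inj_onI, clarify)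
      fix c y c' y'
      assume c: "c \<in> C" "c' \<in> C" and y: "y \<in> level (Suc j)" "y' \<in> level (Suc j)"
        and eq: "t [^] j \<otimes> c \<oplus> y = t [^] j \<otimes> c' \<oplus> y'"
      obtain u u' where u: "u \<in> carrier R" "u' \<in> carrier R" "y = t [^] Suc j \<otimes> u" "y' = t [^] Suc j \<otimes> u'"
        using y unfolding level_def by blast
      have cR: "c \<in> carrier R" "c' \<in> carrier R" using c C(1) by auto
      define z where "z = c \<ominus> c' \<oplus> t \<otimes> (u \<ominus> u')"
      have z: "z \<in> carrier R" unfolding z_def using cR u by simp
      have tj: "t [^] j \<in> carrier R" by simp
      have "t [^] j \<otimes> z = (t [^] j \<otimes> c \<oplus> y) \<ominus> (t [^] j \<otimes> c' \<oplus> y')"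
        unfolding z_def u(3,4) nat_pow_Suc using cR u(1,2) tj t_closed by algebra
      also have "\<dots> = \<zero>" unfolding eq using cR u by (simp add: r_neg minus_eq)
      finally have "t [^] j \<otimes> z = t [^] Suc j \<otimes> \<zero>" by simp
      then have "t [^] j \<otimes> z \<in> level (Suc j)" unfolding level_def by blast
      then have "z \<notin> Units R" using unit_multiple_notin_level[of j "Suc j" z] j by auto
      then obtain w where w: "w \<in> carrier R" "z = t \<otimes> w" using nonunit_iff[OF z] by blast
      have "c = z \<oplus> c' \<ominus> t \<otimes> (u \<ominus> u')" unfolding z_def using cR u(1,2) t_closed by algebra
      also have "\<dots> = c' \<oplus> t \<otimes> (w \<ominus> (u \<ominus> u'))" unfolding w(2) using cR w u(1,2) t_closed by algebra
      finally have "c = c' \<oplus> t \<otimes> (w \<ominus> (u \<ominus> u'))" .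
      moreover have "w \<ominus> (u \<ominus> u') \<in> carrier R" using w u by simp
      ultimately have "c = c'" using unique c by blast
      then show "c = c' \<and> y = y'" using eq cR u by simp
    qed
    show "?f ` (C \<times> level (Suc j)) = level j"
    proof (intro equalityI subsetI)
      fix x assume "x \<in> ?f ` (C \<times> level (Suc j))"
      then obtain c u where "c \<in> C" and u: "u \<in> carrier R" "x = t [^] j \<otimes> c \<oplus> t [^] Suc j \<otimes> u"
        unfolding level_def by auto
      then have c: "c \<in> carrier R" using C(1) by blast
      have "x = t [^] j \<otimes> (c \<oplus> t \<otimes> u)"
        using c u by (simp add: r_distr m_assoc)
      then show "x \<in> level j" unfolding level_def using c u by simp
    next
      fix x assume "x \<in> level j"
      then obtain y where y: "y \<in> carrier R" "x = t [^] j \<otimes> y" unfolding level_def by blast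
      obtain c u where c: "c \<in> C" and u: "u \<in> carrier R" "y = c \<oplus> t \<otimes> u" using covers y(1) by blast
      have cR: "c \<in> carrier R" using c C(1) by blast
      have "x = t [^] j \<otimes> c \<oplus> t [^] Suc j \<otimes> u"
        unfolding y(2) u(2) using cR u(1) by (simp add: r_distr m_assoc)
      moreover have "t [^] Suc j \<otimes> u \<in> level (Suc j)" unfolding level_def using u(1) by blast
      ultimately show "x \<in> ?f ` (C \<times> level (Suc j))" using c by force
    qed
  qed
  then show ?thesis
    using bij_betw_same_card[of ?f "C \<times> level (Suc j)"] bij_betw_finite[of ?f "C \<times> level (Suc j)"] C(2,3) fin
    by (simp add: card_cartesian_product)
qed

lemma level_card: "k \<le> r \<Longrightarrow> finite (level (r - k)) \<and> card (level (r - k)) = q ^ k"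
proof (induction k)
  case 0
  have "level r = {\<zero>}" unfolding level_def by (force simp: t_pow_r)
  then show ?case by simp
next
  case (Suc k)
  then have "Suc (r - Suc k) = r - k" by simp
  then show ?case using level_card_Suc[of "r - Suc k"] Suc by simp
qed

lemma level_0: "level 0 = carrier R"
  unfolding level_def by force

lemma finite_carrier: "finite (carrier R)"
  using level_card[of r] by (simp add: level_0)

lemma card_carrier: "card (carrier R) = q ^ r"
  using level_card[of r] by (simp add: level_0)

lemma card_nonunits: "card (carrier R - Units R) = q ^ (r - 1)"
proof -
  have "carrier R - Units R = level 1"
    unfolding level_def using nonunit_iff t_mult_nonunit by auto
  then show ?thesis using level_card[of "r - 1"] r_pos by simp
qed

end

section \<open>The subgroup of the induction and two counts\<close>

context truncated_dvr begin

lemma level_zero: "\<zero> \<in> level k"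
  unfolding level_def by (intro image_eqI[of _ _ \<zero>]) simp_all

lemma level_add: "x \<in> level k \<Longrightarrow> y \<in> level k \<Longrightarrow> x \<oplus> y \<in> level k"
  unfolding level_def by (auto simp: r_distr[symmetric])

lemma level_mult: "x \<in> level k \<Longrightarrow> y \<in> carrier R \<Longrightarrow> x \<otimes> y \<in> level k"
  unfolding level_def by (auto simp: m_assoc)

lemma level_minus: "x \<in> level k \<Longrightarrow> \<ominus> x \<in> level k"
  unfolding level_def by (auto simp: r_minus[symmetric])

lemma level_mult_level:
  assumes "x \<in> level j" "y \<in> level k" "r \<le> j + k"
  shows "x \<otimes> y = \<zero>"
proof -
  obtain u w where u: "u \<in> carrier R" "x = t [^] j \<otimes> u" "w \<in> carrier R" "y = t [^] k \<otimes> w"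
    using assms(1,2) unfolding level_def by blast
  have "t [^] j \<in> carrier R" "t [^] k \<in> carrier R" by simp_all
  then have "x \<otimes> y = (t [^] j \<otimes> t [^] k) \<otimes> (u \<otimes> w)"
    unfolding u(2,4) using u(1,3) by algebra
  then show ?thesis using t_pow_ge_r[OF assms(3)] u by (simp add: nat_pow_mult)
qed

lemma Mat2_in_split_subgroup_iff:
  "Mat2 a b c d \<in> split_subgroup R t l \<longleftrightarrow>
    a \<in> Units R \<and> b \<in> level l \<and> c \<in> level l \<and> d \<in> Units R"
  unfolding split_subgroup_def level_def by auto

lemma split_subgroup_subset:
  assumes l: "r \<le> 2 * l"
  shows "split_subgroup R t l \<subseteq> carrier (GL2 R)"
proof
  fix x assume "x \<in> split_subgroup R t l"
  then obtain a b c d where x: "x = Mat2 a b c d" "a \<in> Units R" "b \<in> level l" "c \<in> level l" "d \<in> Units R"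
    by (cases x) (auto simp: Mat2_in_split_subgroup_iff)
  then have "b \<otimes> c = \<zero>" using level_mult_level l by simp
  then show "x \<in> carrier (GL2 R)"
    using x by (simp add: Mat2_in_GL2_iff minus_eq Units_closed level_closed)
qed

text \<open>
  The products of off-diagonal entries vanish because \<open>t\<^bsup>2l\<^esup> = 0\<close>; so the diagonal entries multiply,
  which is why \<open>\<mu> \<boxtimes> \<mu>'\<close> is a character.
\<close>

lemma split_subgroup_mult:
  assumes l: "r \<le> 2 * l"
    and "Mat2 a b c d \<in> split_subgroup R t l" "Mat2 a' b' c' d' \<in> split_subgroup R t l"
  shows "Mat2 a b c d \<otimes>\<^bsub>GL2 R\<^esub> Mat2 a' b' c' d' =
      Mat2 (a \<otimes> a') (a \<otimes> b' \<oplus> b \<otimes> d') (c \<otimes> a' \<oplus> d \<otimes> c') (d \<otimes> d')"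
proof -
  have "b \<otimes> c' = \<zero>" "c \<otimes> b' = \<zero>"
    using assms level_mult_level[of _ l _ l] by (simp_all add: Mat2_in_split_subgroup_iff)
  then show ?thesis
    using assms(2,3) by (simp add: GL2_mult mat2_mult Mat2_in_split_subgroup_iff Units_closed)
qed

lemma subgroup_split_subgroup:
  assumes l: "r \<le> 2 * l"
  shows "subgroup (split_subgroup R t l) (GL2 R)"
proof -
  interpret G: group "GL2 R" by (rule GL2_group)
  let ?T = "split_subgroup R t l"
  show ?thesis
  proof
    show "?T \<subseteq> carrier (GL2 R)" by (rule split_subgroup_subset[OF l])
    show "\<one>\<^bsub>GL2 R\<^esub> \<in> ?T" by (simp add: GL2_one Mat2_in_split_subgroup_iff level_zero)
  next
    fix x y assume xy: "x \<in> ?T" "y \<in> ?T"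
    obtain a b c d where x: "x = Mat2 a b c d" by (cases x)
    obtain a' b' c' d' where y: "y = Mat2 a' b' c' d'" by (cases y)
    have c: "a \<in> Units R" "d \<in> Units R" "b' \<in> level l" "c' \<in> level l"
      using xy unfolding x y by (simp_all add: Mat2_in_split_subgroup_iff)
    have comm: "a \<otimes> b' = b' \<otimes> a" "d \<otimes> c' = c' \<otimes> d"
      using m_comm Units_closed[OF c(1)] Units_closed[OF c(2)] level_closed[OF c(3)] level_closed[OF c(4)] by simp_all
    show "x \<otimes>\<^bsub>GL2 R\<^esub> y \<in> ?T"
      using xy split_subgroup_mult[OF l, of a b c d a' b' c' d'] unfolding x y
      by (simp add: Mat2_in_split_subgroup_iff comm level_add level_mult Units_closed)
  next
    fix x assume xT: "x \<in> ?T"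
    obtain a b c d where x: "x = Mat2 a b c d" by (cases x)
    have c: "a \<in> Units R" "b \<in> level l" "c \<in> level l" "d \<in> Units R"
      using xT by (simp_all add: x Mat2_in_split_subgroup_iff)
    define y where "y = Mat2 (inv a) (\<ominus> (b \<otimes> inv a \<otimes> inv d)) (\<ominus> (c \<otimes> inv a \<otimes> inv d)) (inv d)"
    have yT: "y \<in> ?T"
      using c by (simp add: y_def Mat2_in_split_subgroup_iff level_minus level_mult)
    have carr: "a \<in> carrier R" "b \<in> carrier R" "c \<in> carrier R" "d \<in> carrier R" "inv a \<in> carrier R" "inv d \<in> carrier R"
      using c by (simp_all add: Units_closed level_closed)
    have "inv a \<otimes> b \<oplus> \<ominus> (b \<otimes> inv a \<otimes> inv d) \<otimes> d = inv a \<otimes> b \<ominus> inv a \<otimes> b \<otimes> (inv d \<otimes> d)"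
      "\<ominus> (c \<otimes> inv a \<otimes> inv d) \<otimes> a \<oplus> inv d \<otimes> c = inv d \<otimes> c \<ominus> inv d \<otimes> c \<otimes> (inv a \<otimes> a)"
      using carr by algebra+
    then have "y \<otimes>\<^bsub>GL2 R\<^esub> x = \<one>\<^bsub>GL2 R\<^esub>"
      using split_subgroup_mult[OF l yT[unfolded y_def] xT[unfolded x]] c(1,4) carr
      unfolding x y_def by (simp add: GL2_one r_neg minus_eq)
    then have "inv\<^bsub>GL2 R\<^esub> x = y"
      using G.inv_equality xT yT split_subgroup_subset[OF l] by blast
    then show "inv\<^bsub>GL2 R\<^esub> x \<in> ?T" using yT by simp
  qed
qed

lemma card_split_subgroup: "card (split_subgroup R t l) = (card (Units R) * card (level l))\<^sup>2"
proof -
  have "split_subgroup R t l = (\<lambda>(a, b, c, d). Mat2 a b c d) ` (Units R \<times> level l \<times> level l \<times> Units R)"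
  proof (intro equalityI subsetI)
    fix x assume "x \<in> split_subgroup R t l"
    moreover obtain a b c d where x: "x = Mat2 a b c d" by (cases x)
    ultimately have "(a, b, c, d) \<in> Units R \<times> level l \<times> level l \<times> Units R"
      by (simp add: Mat2_in_split_subgroup_iff)
    then show "x \<in> (\<lambda>(a, b, c, d). Mat2 a b c d) ` (Units R \<times> level l \<times> level l \<times> Units R)"
      unfolding x by (rule rev_image_eqI) simp
  qed (auto simp: Mat2_in_split_subgroup_iff)
  moreover have "inj_on (\<lambda>(a, b, c, d). Mat2 a b c d) (Units R \<times> level l \<times> level l \<times> Units R)"
    by (auto simp: inj_on_def)
  ultimately show ?thesis
    by (simp add: card_image card_cartesian_product power2_eq_square)
qed

text \<open>
  When \<open>d\<close> is a nonunit, the determinant is a unit exactly if \<open>b c\<close> is, so neither \<open>a\<close> nor the choice of the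
  nonunit \<open>d\<close> matters for invertibility.
\<close>

lemma card_GL2_nonunit_corner:
  "card {x \<in> carrier (GL2 R). ent22 x \<notin> Units R} = q ^ r * q ^ (r - 1) * (card (Units R))\<^sup>2"
proof -
  let ?D = "carrier R \<times> Units R \<times> Units R \<times> (carrier R - Units R)"
  have det: "a \<otimes> d \<ominus> b \<otimes> c \<in> Units R \<longleftrightarrow> b \<in> Units R \<and> c \<in> Units R"
    if c: "a \<in> carrier R" "b \<in> carrier R" "c \<in> carrier R" "d \<in> carrier R" and d: "d \<notin> Units R" for a b c d
  proof -
    obtain y where y: "y \<in> carrier R" "d = t \<otimes> y" using nonunit_iff[OF c(4)] d by blast
    have *: "a \<otimes> d \<ominus> b \<otimes> c = \<ominus> (b \<otimes> c) \<oplus> t \<otimes> (a \<otimes> y)"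
      "b \<otimes> c = \<ominus> (a \<otimes> d \<ominus> b \<otimes> c) \<oplus> t \<otimes> (a \<otimes> y)"
      unfolding y(2) using c y(1) t_closed by algebra+
    have "b \<otimes> c \<in> Units R" if "a \<otimes> d \<ominus> b \<otimes> c \<in> Units R"
      using Units_add_nonunit[OF Units_uminus[OF that], of "a \<otimes> y"] c(1) y(1)
      by (simp flip: *(2))
    moreover have "a \<otimes> d \<ominus> b \<otimes> c \<in> Units R" if "b \<otimes> c \<in> Units R"
      using Units_add_nonunit[OF Units_uminus[OF that], of "a \<otimes> y"] c(1) y(1)
      by (simp flip: *(1))
    ultimately have "a \<otimes> d \<ominus> b \<otimes> c \<in> Units R \<longleftrightarrow> b \<otimes> c \<in> Units R" by blast
    then show ?thesis using Units_mult_iff c by simp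
  qed
  have "{x \<in> carrier (GL2 R). ent22 x \<notin> Units R} = (\<lambda>(a, b, c, d). Mat2 a b c d) ` ?D"
  proof (intro equalityI subsetI)
    fix x assume "x \<in> {x \<in> carrier (GL2 R). ent22 x \<notin> Units R}"
    moreover obtain a b c d where x: "x = Mat2 a b c d" by (cases x)
    ultimately have "(a, b, c, d) \<in> ?D" using det[of a b c d] by (simp add: Mat2_in_GL2_iff)
    then show "x \<in> (\<lambda>(a, b, c, d). Mat2 a b c d) ` ?D"
      unfolding x by (rule rev_image_eqI) simp
  next
    fix x assume "x \<in> (\<lambda>(a, b, c, d). Mat2 a b c d) ` ?D"
    then show "x \<in> {x \<in> carrier (GL2 R). ent22 x \<notin> Units R}"
      using det by (auto simp: Mat2_in_GL2_iff Units_closed)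
  qed
  moreover have "inj_on (\<lambda>(a, b, c, d). Mat2 a b c d) ?D"
    by (auto simp: inj_on_def)
  ultimately show ?thesis
    by (simp add: card_image card_cartesian_product power2_eq_square card_carrier card_nonunits)
qed

end

section \<open>Regular couples\<close>

text \<open>
  Each \<open>m z\<close> permutes \<open>S\<close>, so the sum may be replaced by its average over all substitutions
  \<open>m z\<close>; the inner sums over \<open>z\<close> then vanish.
\<close>

lemma sum_eq_0_by_averaging:
  fixes f :: "'x \<Rightarrow> complex"
  assumes S: "finite S" and Z: "finite Z" "Z \<noteq> {}"
    and maps: "\<And>z x. z \<in> Z \<Longrightarrow> x \<in> S \<Longrightarrow> m z x \<in> S"
    and inj: "\<And>z. z \<in> Z \<Longrightarrow> inj_on (m z) S"
    and f: "\<And>z x. z \<in> Z \<Longrightarrow> x \<in> S \<Longrightarrow> f (m z x) = f x * c x z"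
    and c: "\<And>x. x \<in> S \<Longrightarrow> (\<Sum>z\<in>Z. c x z) = 0"
  shows "(\<Sum>x\<in>S. f x) = 0"
proof -
  have "(\<Sum>x\<in>S. f (m z x)) = (\<Sum>x\<in>S. f x)" if z: "z \<in> Z" for z
  proof -
    have "m z ` S = S" using endo_inj_surj[OF S _ inj[OF z]] maps[OF z] by blast
    then show ?thesis using sum.reindex[OF inj[OF z], of f] by simp
  qed
  then have "of_nat (card Z) * (\<Sum>x\<in>S. f x) = (\<Sum>z\<in>Z. \<Sum>x\<in>S. f (m z x))"
    by simp
  also have "\<dots> = (\<Sum>z\<in>Z. \<Sum>x\<in>S. f x * c x z)"
    by (intro sum.cong refl f)
  also have "\<dots> = (\<Sum>x\<in>S. f x * (\<Sum>z\<in>Z. c x z))"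
    by (subst sum.swap) (simp add: sum_distrib_left)
  also have "\<dots> = 0" by (simp add: c)
  finally show ?thesis using Z by simp
qed

locale regular_characters = truncated_dvr +
  fixes \<mu> \<mu>' :: "'a \<Rightarrow> complex"
  assumes regular: "regular_couple R t r \<mu> \<mu>'"
    and r_ge_2: "2 \<le> r"
begin

lemma character_hom:
  "\<mu> \<in> hom (units_of R) complex_units" "\<mu>' \<in> hom (units_of R) complex_units"
  using regular unfolding regular_couple_def by blast+

lemma character_mult:
  assumes "x \<in> Units R" "y \<in> Units R"
  shows "\<mu> (x \<otimes> y) = \<mu> x * \<mu> y" "\<mu>' (x \<otimes> y) = \<mu>' x * \<mu>' y"
  using hom_mult[OF character_hom(1), of x y] hom_mult[OF character_hom(2), of x y] assms
  by (simp_all add: units_of_carrier units_of_mult complex_units_def)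

lemma character_nonzero:
  assumes "x \<in> Units R"
  shows "\<mu> x \<noteq> 0" "\<mu>' x \<noteq> 0"
  using hom_in_carrier[OF character_hom(1), of x] hom_in_carrier[OF character_hom(2), of x] assms
  by (simp_all add: units_of_carrier complex_units_def)

lemma character_one: "\<mu> \<one> = 1" "\<mu>' \<one> = 1"
  using character_mult[of \<one> \<one>] character_nonzero[of \<one>] by simp_all

text \<open>
  The restriction of \<open>\<mu> / \<mu>'\<close> to \<open>1 + t\<^bsup>r-1\<^esup> R\<close>, viewed as an additive character of \<open>R\<close>. It is
  additive because \<open>2 (r - 1) \<ge> r\<close>, and the regularity of the couple says that it is nontrivial.
\<close>

definition \<psi> :: "'a \<Rightarrow> complex" where
  "\<psi> u = \<mu> (\<one> \<oplus> t [^] (r - 1) \<otimes> u) * inverse (\<mu>' (\<one> \<oplus> t [^] (r - 1) \<otimes> u))"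

lemma Units_add_t_pow:
  fixes j :: nat
  assumes "u \<in> Units R" "y \<in> carrier R" "0 < j"
  shows "u \<oplus> t [^] j \<otimes> y \<in> Units R"
proof -
  have "t [^] j = t \<otimes> t [^] (j - 1)"
    using assms(3) by (cases j) (simp_all add: m_comm)
  then show ?thesis
    using Units_add_nonunit[OF assms(1), of "t [^] (j - 1) \<otimes> y"] assms(2) by (simp add: m_assoc)
qed

lemma t_pow_mult_zero: "x \<in> carrier R \<Longrightarrow> r \<le> j + k \<Longrightarrow> t [^] j \<otimes> (t [^] k \<otimes> x) = \<zero>"
  for j k :: nat
  using t_pow_ge_r[of "j + k"] by (simp add: m_assoc[symmetric] nat_pow_mult)

lemma top_unit: "u \<in> carrier R \<Longrightarrow> \<one> \<oplus> t [^] (r - 1) \<otimes> u \<in> Units R"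
  using Units_add_t_pow[of \<one> u "r - 1"] r_ge_2 by simp

lemma top_unit_mult:
  assumes u: "u \<in> carrier R" and y: "y \<in> carrier R"
  shows "(\<one> \<oplus> t [^] (r - 1) \<otimes> u) \<otimes> (\<one> \<oplus> t [^] (r - 1) \<otimes> y) = \<one> \<oplus> t [^] (r - 1) \<otimes> (u \<oplus> y)"
proof -
  have T: "t [^] (r - 1) \<in> carrier R" by simp
  have "(\<one> \<oplus> t [^] (r - 1) \<otimes> u) \<otimes> (\<one> \<oplus> t [^] (r - 1) \<otimes> y) =
      \<one> \<oplus> t [^] (r - 1) \<otimes> (u \<oplus> y) \<oplus> t [^] (r - 1) \<otimes> (t [^] (r - 1) \<otimes> (u \<otimes> y))"
    using u y T by algebra
  also have "t [^] (r - 1) \<otimes> (t [^] (r - 1) \<otimes> (u \<otimes> y)) = \<zero>"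
    using u y r_ge_2 by (intro t_pow_mult_zero) auto
  finally show ?thesis using u y by simp
qed

lemma \<psi>_add: "u \<in> carrier R \<Longrightarrow> y \<in> carrier R \<Longrightarrow> \<psi> (u \<oplus> y) = \<psi> u * \<psi> y"
  unfolding \<psi>_def using top_unit_mult[of u y, symmetric] character_mult[OF top_unit top_unit, of u y]
  by simp

lemma \<psi>_nontrivial: "\<exists>z\<in>carrier R. \<psi> z \<noteq> 1"
  using regular unfolding regular_couple_def \<psi>_def by blast

text \<open>
  Orthogonality: translating \<open>z\<close> by \<open>\<kappa>\<inverse> z0\<close>, with \<open>\<psi> z0 \<noteq> 1\<close>, multiplies the sum by \<open>\<psi> z0\<close>.
\<close>

lemma sum_\<psi>:
  assumes \<kappa>: "\<kappa> \<in> Units R"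
  shows "(\<Sum>z\<in>carrier R. \<psi> (\<kappa> \<otimes> z)) = 0"
proof -
  obtain z0 where z0: "z0 \<in> carrier R" "\<psi> z0 \<noteq> 1" using \<psi>_nontrivial by blast
  have \<kappa>R: "\<kappa> \<in> carrier R" using \<kappa> by (rule Units_closed)
  define z1 where "z1 = inv \<kappa> \<otimes> z0"
  have z1: "z1 \<in> carrier R" "\<kappa> \<otimes> z1 = z0"
    using \<kappa> \<kappa>R z0(1) by (simp_all add: z1_def m_assoc[symmetric])
  have inj: "inj_on (\<lambda>z. z \<oplus> z1) (carrier R)"
    using z1(1) by (intro inj_onI) simp
  have im: "(\<lambda>z. z \<oplus> z1) ` carrier R = carrier R"
    using z1(1) by (intro endo_inj_surj finite_carrier inj) auto
  define s where "s = (\<Sum>z\<in>carrier R. \<psi> (\<kappa> \<otimes> z))"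
  have "s = (\<Sum>z\<in>carrier R. \<psi> (\<kappa> \<otimes> (z \<oplus> z1)))"
    unfolding s_def
    using sum.reindex[OF inj, of "\<lambda>z. \<psi> (\<kappa> \<otimes> z)"] im by simp
  also have "\<dots> = (\<Sum>z\<in>carrier R. \<psi> (\<kappa> \<otimes> z) * \<psi> z0)"
    using \<kappa>R z1 by (intro sum.cong refl) (simp add: r_distr \<psi>_add z0(1))
  also have "\<dots> = s * \<psi> z0" by (simp add: s_def sum_distrib_right)
  finally have "s = 0" using z0(2) by (metis mult_cancel_left2)
  then show ?thesis by (simp add: s_def)
qed

text \<open>
  Since \<open>t\<^sup>i t\<^bsup>r-1\<^esup> = 0\<close> for \<open>i > 0\<close>, the unit \<open>\<alpha> + t\<^sup>i P\<close> acts on \<open>t\<^bsup>r-1\<^esup> R\<close> like \<open>\<alpha>\<close>.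
  A perturbation by \<open>t\<^bsup>r-1\<^esup> y\<close> is therefore multiplication by \<open>1 + t\<^bsup>r-1\<^esup> \<alpha>\<inverse> y\<close>.
\<close>

lemma character_perturb:
  fixes i :: nat
  assumes \<alpha>: "\<alpha> \<in> Units R" and P: "P \<in> carrier R" and y: "y \<in> carrier R" and i: "0 < i"
  shows "\<mu> (\<alpha> \<oplus> (t [^] i \<otimes> P \<oplus> t [^] (r - 1) \<otimes> y)) * \<mu>' (\<alpha> \<ominus> (t [^] i \<otimes> P \<oplus> t [^] (r - 1) \<otimes> y)) =
    \<mu> (\<alpha> \<oplus> t [^] i \<otimes> P) * \<mu>' (\<alpha> \<ominus> t [^] i \<otimes> P) * \<psi> (inv \<alpha> \<otimes> y)"
proof -
  define u where "u = inv \<alpha> \<otimes> y"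
  have \<alpha>R: "\<alpha> \<in> carrier R" using \<alpha> by (rule Units_closed)
  have u: "u \<in> carrier R" "\<alpha> \<otimes> u = y" using \<alpha> \<alpha>R y by (simp_all add: u_def m_assoc[symmetric])
  have T: "t [^] (r - 1) \<in> carrier R" "t [^] i \<in> carrier R" by simp_all
  have zero: "t [^] i \<otimes> (t [^] (r - 1) \<otimes> (P \<otimes> u)) = \<zero>"
    using P u i by (intro t_pow_mult_zero) auto
  have U: "\<alpha> \<oplus> t [^] i \<otimes> P \<in> Units R" "\<alpha> \<ominus> t [^] i \<otimes> P \<in> Units R"
    using Units_add_t_pow[OF \<alpha> P i] Units_add_t_pow[OF \<alpha> a_inv_closed[OF P] i] P
    by (simp_all add: minus_eq r_minus)
  have "(\<alpha> \<oplus> t [^] i \<otimes> P) \<otimes> (\<one> \<oplus> t [^] (r - 1) \<otimes> u) =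
      \<alpha> \<oplus> (t [^] i \<otimes> P \<oplus> t [^] (r - 1) \<otimes> (\<alpha> \<otimes> u)) \<oplus> t [^] i \<otimes> (t [^] (r - 1) \<otimes> (P \<otimes> u))"
    using \<alpha>R P u(1) T by algebra
  then have 1: "\<alpha> \<oplus> (t [^] i \<otimes> P \<oplus> t [^] (r - 1) \<otimes> y) =
      (\<alpha> \<oplus> t [^] i \<otimes> P) \<otimes> (\<one> \<oplus> t [^] (r - 1) \<otimes> u)"
    unfolding zero u(2) using \<alpha>R P y by simp
  have "(\<alpha> \<ominus> t [^] i \<otimes> P) \<otimes> (\<one> \<oplus> t [^] (r - 1) \<otimes> (\<ominus> u)) =
      \<alpha> \<ominus> (t [^] i \<otimes> P \<oplus> t [^] (r - 1) \<otimes> (\<alpha> \<otimes> u)) \<oplus> t [^] i \<otimes> (t [^] (r - 1) \<otimes> (P \<otimes> u))"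
    using \<alpha>R P u(1) T by algebra
  then have 2: "\<alpha> \<ominus> (t [^] i \<otimes> P \<oplus> t [^] (r - 1) \<otimes> y) =
      (\<alpha> \<ominus> t [^] i \<otimes> P) \<otimes> (\<one> \<oplus> t [^] (r - 1) \<otimes> (\<ominus> u))"
    unfolding zero u(2) using \<alpha>R P y by simp
  have "\<mu>' (\<one> \<oplus> t [^] (r - 1) \<otimes> u) * \<mu>' (\<one> \<oplus> t [^] (r - 1) \<otimes> (\<ominus> u)) = 1"
    using character_mult(2)[OF top_unit top_unit, of u "\<ominus> u"] top_unit_mult[of u "\<ominus> u"] u(1)
    by (simp add: r_neg character_one)
  then have 3: "\<mu>' (\<one> \<oplus> t [^] (r - 1) \<otimes> (\<ominus> u)) = inverse (\<mu>' (\<one> \<oplus> t [^] (r - 1) \<otimes> u))"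
    by (metis inverse_unique)
  show ?thesis
    unfolding 1 2 u_def[symmetric] 3 \<psi>_def
      character_mult(1)[OF U(1) top_unit[OF u(1)]]
      character_mult(2)[OF U(2) top_unit[OF a_inv_closed[OF u(1)]]]
    by simp
qed

lemma boxtimes_mult:
  assumes "r \<le> 2 * l" and "h \<in> split_subgroup R t l" and "k \<in> split_subgroup R t l"
  shows "boxtimes \<mu> \<mu>' (h \<otimes>\<^bsub>GL2 R\<^esub> k) = boxtimes \<mu> \<mu>' h * boxtimes \<mu> \<mu>' k"
proof (cases h; cases k)
  fix a b c d a' b' c' d' assume "h = Mat2 a b c d" "k = Mat2 a' b' c' d'"
  then show ?thesis
    using assms split_subgroup_mult[of l a b c d a' b' c' d']
    by (simp add: boxtimes_def Mat2_in_split_subgroup_iff character_mult)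
qed

text \<open>
  Modulo \<open>t\<close> the entry is \<open>d\<^sup>2\<close> divided by the determinant.
\<close>

lemma conj21_unit:
  assumes "Mat2 a b c d \<in> carrier (GL2 R)" "d \<in> Units R" "\<beta> \<in> carrier R"
  shows "conj21 (t \<otimes> \<beta>) a b c d \<in> Units R"
proof -
  have c: "c \<in> carrier R" "d \<in> carrier R" and u: "a \<otimes> d \<ominus> b \<otimes> c \<in> Units R"
    using assms(1) by (simp_all add: Mat2_in_GL2_iff)
  have "d \<otimes> d \<ominus> t \<otimes> \<beta> \<otimes> c \<otimes> c = d \<otimes> d \<oplus> t \<otimes> (\<ominus> (\<beta> \<otimes> c \<otimes> c))"
    using c assms(3) t_closed by algebra
  then show ?thesis
    unfolding conj21_def using u assms(2,3) c Units_add_nonunit[of "d \<otimes> d" "\<ominus> (\<beta> \<otimes> c \<otimes> c)"] by simp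
qed

text \<open>
  Modulo \<open>t\<close> the entry is \<open>- b\<^sup>2\<close> divided by the determinant.
\<close>

lemma conj12_unit:
  assumes "Mat2 a b c d \<in> carrier (GL2 R)" "b \<in> Units R" "\<beta> \<in> carrier R"
  shows "conj12 (t \<otimes> \<beta>) a b c d \<in> Units R"
proof -
  have c: "a \<in> carrier R" "b \<in> carrier R" and u: "a \<otimes> d \<ominus> b \<otimes> c \<in> Units R"
    using assms(1) by (simp_all add: Mat2_in_GL2_iff)
  have "t \<otimes> \<beta> \<otimes> a \<otimes> a \<ominus> b \<otimes> b = \<ominus> (b \<otimes> b) \<oplus> t \<otimes> (\<beta> \<otimes> a \<otimes> a)"
    using c assms(3) t_closed by algebra
  then show ?thesis
    unfolding conj12_def
    using u assms(2,3) c Units_add_nonunit[OF Units_uminus, of "b \<otimes> b" "\<beta> \<otimes> a \<otimes> a"] by simp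
qed

lemma GL2_nonunit_corner:
  assumes "Mat2 a b c d \<in> carrier (GL2 R)" "d \<notin> Units R"
  shows "b \<in> Units R"
proof (rule ccontr)
  have c: "a \<in> carrier R" "b \<in> carrier R" "c \<in> carrier R" "d \<in> carrier R"
    and u: "a \<otimes> d \<ominus> b \<otimes> c \<in> Units R"
    using assms(1) by (simp_all add: Mat2_in_GL2_iff)
  assume "b \<notin> Units R"
  then obtain y z where yz: "y \<in> carrier R" "b = t \<otimes> y" "z \<in> carrier R" "d = t \<otimes> z"
    using nonunit_iff[OF c(2)] nonunit_iff[OF c(4)] assms(2) by blast
  have "a \<otimes> d \<ominus> b \<otimes> c = t \<otimes> (a \<otimes> z \<ominus> y \<otimes> c)"
    unfolding yz(2,4) using c(1,3) yz(1,3) t_closed by algebra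
  then show False using u t_mult_nonunit[of "a \<otimes> z \<ominus> y \<otimes> c"] c yz by simp
qed

end

locale principal_split_trace = regular_characters +
  fixes i :: nat and \<alpha> \<beta> :: 'a
  assumes i_le: "i \<le> r - 1" and \<alpha>_unit: "\<alpha> \<in> Units R" and \<beta>_closed: "\<beta> \<in> carrier R"
begin

abbreviation B :: "'a mat2" where "B \<equiv> B_mat R t i \<alpha> \<beta>"

text \<open>
  The entry \<open>X\<^sub>1\<^sub>1\<close> of the conjugate \<open>\<alpha> + t\<^sup>i X\<close> of \<open>B\<close> by \<open>x\<close>.
\<close>

definition conj_entry :: "'a mat2 \<Rightarrow> 'a" where
  "conj_entry x = conj11 (t \<otimes> \<beta>) (ent11 x) (ent12 x) (ent21 x) (ent22 x)"

definition summand :: "'a mat2 \<Rightarrow> complex" where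
  "summand x = \<mu> (\<alpha> \<oplus> t [^] i \<otimes> conj_entry x) * \<mu>' (\<alpha> \<ominus> t [^] i \<otimes> conj_entry x)"

lemma \<alpha>_closed: "\<alpha> \<in> carrier R"
  using \<alpha>_unit by (rule Units_closed)

lemma e_closed: "t \<otimes> \<beta> \<in> carrier R"
  using \<beta>_closed by simp

lemma B_eq: "B = Mat2 \<alpha> (t [^] i \<otimes> (t \<otimes> \<beta>)) (t [^] i) \<alpha>"
  using \<beta>_closed by (simp add: B_mat_def m_assoc)

lemma B_in_GL2: "B \<in> carrier (GL2 R)"
proof -
  have T: "t [^] i \<in> carrier R" by simp
  have "\<alpha> \<otimes> \<alpha> \<ominus> t [^] i \<otimes> (t \<otimes> \<beta>) \<otimes> t [^] i = \<alpha> \<otimes> \<alpha> \<oplus> t \<otimes> (\<ominus> (t [^] i \<otimes> \<beta> \<otimes> t [^] i))"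
    using \<alpha>_closed \<beta>_closed T t_closed by algebra
  then have "\<alpha> \<otimes> \<alpha> \<ominus> t [^] i \<otimes> (t \<otimes> \<beta>) \<otimes> t [^] i \<in> Units R"
    using Units_add_nonunit[of "\<alpha> \<otimes> \<alpha>" "\<ominus> (t [^] i \<otimes> \<beta> \<otimes> t [^] i)"] \<alpha>_unit \<beta>_closed by simp
  then show ?thesis using \<alpha>_closed \<beta>_closed by (simp add: B_eq Mat2_in_GL2_iff)
qed

lemma conj_B:
  assumes "Mat2 a b c d \<in> carrier (GL2 R)"
  shows "Mat2 a b c d \<otimes>\<^bsub>GL2 R\<^esub> B \<otimes>\<^bsub>GL2 R\<^esub> inv\<^bsub>GL2 R\<^esub> Mat2 a b c d =
    Mat2 (\<alpha> \<oplus> t [^] i \<otimes> conj11 (t \<otimes> \<beta>) a b c d) (t [^] i \<otimes> conj12 (t \<otimes> \<beta>) a b c d)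
      (t [^] i \<otimes> conj21 (t \<otimes> \<beta>) a b c d) (\<alpha> \<ominus> t [^] i \<otimes> conj11 (t \<otimes> \<beta>) a b c d)"
  using GL2_conj[OF assms \<alpha>_closed _ e_closed B_in_GL2[unfolded B_eq]] by (simp add: B_eq)

text \<open>
  One of the off-diagonal entries of the conjugate is \<open>t\<^sup>i\<close> times a unit.
\<close>

lemma conj_B_notin_split_subgroup:
  assumes x: "x \<in> carrier (GL2 R)" and l: "i < l" "l \<le> r"
  shows "x \<otimes>\<^bsub>GL2 R\<^esub> B \<otimes>\<^bsub>GL2 R\<^esub> inv\<^bsub>GL2 R\<^esub> x \<notin> split_subgroup R t l"
proof -
  obtain a b c d where x_eq: "x = Mat2 a b c d" by (cases x)
  note conj = conj_B[OF x[unfolded x_eq], folded x_eq]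
  show ?thesis
  proof (cases "d \<in> Units R")
    case True
    then show ?thesis
      using unit_multiple_notin_level[OF l conj21_unit[OF x[unfolded x_eq] True \<beta>_closed]]
      unfolding conj by (simp add: Mat2_in_split_subgroup_iff)
  next
    case False
    then show ?thesis
      using unit_multiple_notin_level[OF l conj12_unit[OF x[unfolded x_eq] GL2_nonunit_corner[OF x[unfolded x_eq] False] \<beta>_closed]]
      unfolding conj by (simp add: Mat2_in_split_subgroup_iff)
  qed
qed

lemma conj_B_in_split_subgroup:
  assumes x: "x \<in> carrier (GL2 R)" and l: "l \<le> i" "0 < l"
  shows "x \<otimes>\<^bsub>GL2 R\<^esub> B \<otimes>\<^bsub>GL2 R\<^esub> inv\<^bsub>GL2 R\<^esub> x \<in> split_subgroup R t l"
    and "boxtimes \<mu> \<mu>' (x \<otimes>\<^bsub>GL2 R\<^esub> B \<otimes>\<^bsub>GL2 R\<^esub> inv\<^bsub>GL2 R\<^esub> x) = summand x"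
proof -
  obtain a b c d where x_eq: "x = Mat2 a b c d" by (cases x)
  note conj = conj_B[OF x[unfolded x_eq], folded x_eq]
  let ?P = "conj11 (t \<otimes> \<beta>) a b c d"
  note closed = conj_closed[OF x[unfolded x_eq] e_closed]
  have "\<alpha> \<ominus> t [^] i \<otimes> ?P = \<alpha> \<oplus> t [^] i \<otimes> (\<ominus> ?P)"
    using closed(1) by (simp add: minus_eq r_minus)
  then show "x \<otimes>\<^bsub>GL2 R\<^esub> B \<otimes>\<^bsub>GL2 R\<^esub> inv\<^bsub>GL2 R\<^esub> x \<in> split_subgroup R t l"
    unfolding conj using closed l Units_add_t_pow[OF \<alpha>_unit, of _ i]
    by (simp add: Mat2_in_split_subgroup_iff level_mono)
  show "boxtimes \<mu> \<mu>' (x \<otimes>\<^bsub>GL2 R\<^esub> B \<otimes>\<^bsub>GL2 R\<^esub> inv\<^bsub>GL2 R\<^esub> x) = summand x"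
    unfolding conj by (simp add: boxtimes_def summand_def conj_entry_def x_eq)
qed

text \<open>
  A change of \<open>X\<^sub>1\<^sub>1\<close> by a multiple of \<open>t\<^bsup>r-1-i\<^esup>\<close> changes \<open>t\<^sup>i X\<^sub>1\<^sub>1\<close> by an element of
  \<open>t\<^bsup>r-1\<^esup> R\<close>, which is where \<open>\<psi>\<close> sees it.
\<close>

lemma summand_perturb:
  assumes "0 < i" "z \<in> carrier R" "S \<in> carrier R" "conj_entry x \<in> carrier R"
    and "conj_entry y = conj_entry x \<oplus> t [^] (r - 1 - i) \<otimes> z \<otimes> S"
  shows "summand y = summand x * \<psi> (inv \<alpha> \<otimes> S \<otimes> z)"
proof -
  have T: "t [^] i \<in> carrier R" "t [^] (r - 1 - i) \<in> carrier R" by simp_all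
  have "t [^] i \<otimes> t [^] (r - 1 - i) = t [^] (r - 1)"
    using i_le by (simp only: nat_pow_mult[OF t_closed] le_add_diff_inverse)
  moreover have "t [^] i \<otimes> conj_entry y =
      t [^] i \<otimes> conj_entry x \<oplus> (t [^] i \<otimes> t [^] (r - 1 - i)) \<otimes> (S \<otimes> z)"
    unfolding assms(5) using T assms(2-4) by algebra
  ultimately have "t [^] i \<otimes> conj_entry y = t [^] i \<otimes> conj_entry x \<oplus> t [^] (r - 1) \<otimes> (S \<otimes> z)"
    by simp
  then show ?thesis
    unfolding summand_def using character_perturb[OF \<alpha>_unit assms(4) _ assms(1), of "S \<otimes> z"] assms(2,3) \<alpha>_unit
    by (simp add: m_assoc)
qed

lemma conj_entry_closed: "x \<in> carrier (GL2 R) \<Longrightarrow> conj_entry x \<in> carrier R"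
  by (cases x) (simp add: conj_entry_def conj_closed e_closed)

text \<open>
  Averaging over the upper unipotents, which leave \<open>d\<close> alone: here \<open>X\<^sub>2\<^sub>1\<close> is a unit.
\<close>

lemma sum_summand_unit_corner:
  assumes i: "0 < i"
  shows "(\<Sum>x\<in>{x \<in> carrier (GL2 R). ent22 x \<in> Units R}. summand x) = 0" (is "(\<Sum>x\<in>?S. _) = 0")
proof (rule sum_eq_0_by_averaging[where Z = "carrier R"
    and m = "\<lambda>z. upper_shear (t [^] (r - 1 - i) \<otimes> z)"
    and c = "\<lambda>x z. \<psi> (inv \<alpha> \<otimes> conj21 (t \<otimes> \<beta>) (ent11 x) (ent12 x) (ent21 x) (ent22 x) \<otimes> z)"])
  show "finite ?S" using finite_GL2[OF finite_carrier] by simp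
  show "finite (carrier R)" "carrier R \<noteq> {}" using finite_carrier by auto
  fix z assume z: "z \<in> carrier R"
  let ?s = "t [^] (r - 1 - i) \<otimes> z"
  have s: "?s \<in> carrier R" using z by simp
  show "inj_on (upper_shear ?s) ?S"
    by (rule inj_on_subset[OF inj_on_shear(1)[OF s]]) blast
  fix x assume x: "x \<in> ?S"
  obtain a b c d where x_eq: "x = Mat2 a b c d" by (cases x)
  have xG: "Mat2 a b c d \<in> carrier (GL2 R)" using x x_eq by simp
  show "upper_shear ?s x \<in> ?S"
    using GL2_upper_shear(1)[OF xG s e_closed] x by (simp add: x_eq upper_shear_def)
  have "conj_entry (upper_shear ?s x) = conj_entry x \<oplus> ?s \<otimes> conj21 (t \<otimes> \<beta>) a b c d"
    unfolding conj_entry_def x_eq upper_shear_def mat2.sel by (rule GL2_upper_shear(2)[OF xG s e_closed])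
  then have "summand (upper_shear ?s x) = summand x * \<psi> (inv \<alpha> \<otimes> conj21 (t \<otimes> \<beta>) a b c d \<otimes> z)"
    using summand_perturb[OF i z] conj_closed(3)[OF xG e_closed] conj_entry_closed x by simp
  then show "summand (upper_shear ?s x) =
      summand x * \<psi> (inv \<alpha> \<otimes> conj21 (t \<otimes> \<beta>) (ent11 x) (ent12 x) (ent21 x) (ent22 x) \<otimes> z)"
    by (simp add: x_eq)
next
  fix x assume x: "x \<in> ?S"
  then have "conj21 (t \<otimes> \<beta>) (ent11 x) (ent12 x) (ent21 x) (ent22 x) \<in> Units R"
    using conj21_unit \<beta>_closed by (cases x) simp
  then show "(\<Sum>z\<in>carrier R. \<psi> (inv \<alpha> \<otimes> conj21 (t \<otimes> \<beta>) (ent11 x) (ent12 x) (ent21 x) (ent22 x) \<otimes> z)) = 0"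
    using \<alpha>_unit by (intro sum_\<psi>) simp
qed

text \<open>
  Averaging over the lower unipotents: here \<open>X\<^sub>1\<^sub>2\<close> is a unit. The condition \<open>i < r - 1\<close> makes
  \<open>s = t\<^bsup>r-1-i\<^esup> z\<close> a nonunit, so that \<open>d + s b\<close> remains one.
\<close>

lemma sum_summand_nonunit_corner:
  assumes i: "0 < i" "i < r - 1"
  shows "(\<Sum>x\<in>{x \<in> carrier (GL2 R). ent22 x \<notin> Units R}. summand x) = 0" (is "(\<Sum>x\<in>?S. _) = 0")
proof (rule sum_eq_0_by_averaging[where Z = "carrier R"
    and m = "\<lambda>z. lower_shear (t [^] (r - 1 - i) \<otimes> z)"
    and c = "\<lambda>x z. \<psi> (inv \<alpha> \<otimes> (\<ominus> conj12 (t \<otimes> \<beta>) (ent11 x) (ent12 x) (ent21 x) (ent22 x)) \<otimes> z)"])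
  show "finite ?S" using finite_GL2[OF finite_carrier] by simp
  show "finite (carrier R)" "carrier R \<noteq> {}" using finite_carrier by auto
  fix z assume z: "z \<in> carrier R"
  let ?s = "t [^] (r - 1 - i) \<otimes> z"
  have s: "?s \<in> carrier R" using z by simp
  show "inj_on (lower_shear ?s) ?S"
    by (rule inj_on_subset[OF inj_on_shear(2)[OF s]]) blast
  fix x assume x: "x \<in> ?S"
  obtain a b c d where x_eq: "x = Mat2 a b c d" by (cases x)
  have xG: "Mat2 a b c d \<in> carrier (GL2 R)" using x x_eq by simp
  have c: "b \<in> carrier R" "d \<in> carrier R" using xG by (simp_all add: Mat2_in_GL2_iff)
  obtain y where y: "y \<in> carrier R" "d = t \<otimes> y" using nonunit_iff[OF c(2)] x x_eq by auto
  define T where "T = t [^] (r - 2 - i)"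
  have T: "T \<in> carrier R" by (simp add: T_def)
  have "r - 1 - i = Suc (r - 2 - i)" using i by simp
  then have "t [^] (r - 1 - i) = T \<otimes> t" by (simp only: nat_pow_Suc T_def)
  then have "d \<oplus> ?s \<otimes> b = t \<otimes> y \<oplus> T \<otimes> t \<otimes> z \<otimes> b" unfolding y(2) by (simp only:)
  also have "\<dots> = t \<otimes> (y \<oplus> T \<otimes> z \<otimes> b)"
    using y(1) c(1) z T t_closed by algebra
  finally have "d \<oplus> ?s \<otimes> b \<notin> Units R"
    using t_mult_nonunit[of "y \<oplus> T \<otimes> z \<otimes> b"] y(1) c(1) z T by simp
  then show "lower_shear ?s x \<in> ?S"
    using GL2_lower_shear(1)[OF xG s e_closed] x by (simp add: x_eq lower_shear_def)
  have Q: "conj12 (t \<otimes> \<beta>) a b c d \<in> carrier R" by (rule conj_closed(2)[OF xG e_closed])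
  have "conj_entry (lower_shear ?s x) = conj_entry x \<ominus> ?s \<otimes> conj12 (t \<otimes> \<beta>) a b c d"
    unfolding conj_entry_def x_eq lower_shear_def mat2.sel by (rule GL2_lower_shear(2)[OF xG s e_closed])
  then have "conj_entry (lower_shear ?s x) = conj_entry x \<oplus> ?s \<otimes> (\<ominus> conj12 (t \<otimes> \<beta>) a b c d)"
    using s Q by (simp add: minus_eq r_minus)
  then have "summand (lower_shear ?s x) = summand x * \<psi> (inv \<alpha> \<otimes> (\<ominus> conj12 (t \<otimes> \<beta>) a b c d) \<otimes> z)"
    using summand_perturb[OF i(1) z a_inv_closed[OF Q]] conj_entry_closed x by blast
  then show "summand (lower_shear ?s x) =
      summand x * \<psi> (inv \<alpha> \<otimes> (\<ominus> conj12 (t \<otimes> \<beta>) (ent11 x) (ent12 x) (ent21 x) (ent22 x)) \<otimes> z)"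
    by (simp add: x_eq)
next
  fix x assume x: "x \<in> ?S"
  then have "conj12 (t \<otimes> \<beta>) (ent11 x) (ent12 x) (ent21 x) (ent22 x) \<in> Units R"
    by (cases x) (auto intro: conj12_unit GL2_nonunit_corner \<beta>_closed)
  then have "inv \<alpha> \<otimes> (\<ominus> conj12 (t \<otimes> \<beta>) (ent11 x) (ent12 x) (ent21 x) (ent22 x)) \<in> Units R"
    using \<alpha>_unit Units_uminus Units_m_closed Units_inv_Units by blast
  then show "(\<Sum>z\<in>carrier R. \<psi> (inv \<alpha> \<otimes> (\<ominus> conj12 (t \<otimes> \<beta>) (ent11 x) (ent12 x) (ent21 x) (ent22 x)) \<otimes> z)) = 0"
    by (rule sum_\<psi>)
qed

text \<open>
  If \<open>t\<close> divides \<open>d\<close> then it divides \<open>X\<^sub>1\<^sub>1 = (b d - t \<beta> a c) / det x\<close>, and \<open>t\<^bsup>r-1\<^esup> t = 0\<close>.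
\<close>

lemma summand_top:
  assumes i: "i = r - 1" and x: "x \<in> carrier (GL2 R)" "ent22 x \<notin> Units R"
  shows "summand x = \<mu> \<alpha> * \<mu>' \<alpha>"
proof -
  obtain a b c d where x_eq: "x = Mat2 a b c d" by (cases x)
  have c: "a \<in> carrier R" "b \<in> carrier R" "c \<in> carrier R" "d \<in> carrier R"
    and u: "a \<otimes> d \<ominus> b \<otimes> c \<in> Units R"
    using x(1) by (simp_all add: Mat2_in_GL2_iff x_eq)
  define \<delta> where "\<delta> = inv (a \<otimes> d \<ominus> b \<otimes> c)"
  have \<delta>: "\<delta> \<in> carrier R" using u by (simp add: \<delta>_def)
  obtain y where y: "y \<in> carrier R" "d = t \<otimes> y" using nonunit_iff[OF c(4)] x(2) x_eq by auto
  define w where "w = \<delta> \<otimes> (b \<otimes> y \<ominus> \<beta> \<otimes> a \<otimes> c)"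
  have w: "w \<in> carrier R" using c y \<delta> \<beta>_closed by (simp add: w_def)
  have "conj_entry x = t \<otimes> w"
    unfolding conj_entry_def x_eq mat2.sel conj11_def \<delta>_def[symmetric] w_def
    unfolding y(2) using c y(1) \<delta> \<beta>_closed t_closed by algebra
  then have "t [^] i \<otimes> conj_entry x = t [^] (r - 1) \<otimes> (t [^] (1::nat) \<otimes> w)" using i by simp
  also have "\<dots> = \<zero>" using w by (intro t_pow_mult_zero) auto
  finally show ?thesis unfolding summand_def using \<alpha>_closed by (simp add: minus_eq)
qed

lemma ind_character_B:
  assumes r: "r = 2 * l"
  shows "ind_character (GL2 R) (split_subgroup R t l) (boxtimes \<mu> \<mu>') B =
    (if i = r - 1 then 1 else 0) * of_nat q ^ (r - 1) * \<mu> \<alpha> * \<mu>' \<alpha>"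
proof -
  let ?G = "GL2 R" and ?T = "split_subgroup R t l" and ?\<chi> = "boxtimes \<mu> \<mu>'"
  let ?unit = "{x \<in> carrier ?G. ent22 x \<in> Units R}" and ?non = "{x \<in> carrier ?G. ent22 x \<notin> Units R}"
  have finG: "finite (carrier ?G)" by (rule finite_GL2[OF finite_carrier])
  have l: "0 < l" using r r_ge_2 by simp
  have one: "?\<chi> \<one>\<^bsub>?G\<^esub> = 1" by (simp add: boxtimes_def GL2_one character_one)
  have finU: "finite (Units R)" using finite_carrier by (rule rev_finite_subset) auto
  have cardU: "card (Units R) \<noteq> 0" using finU Units_one_closed by auto
  have q: "q \<noteq> 0" using card_carrier finite_carrier r_pos by (metis card_0_eq carrier_not_empty power_0_left neq0_conv)
  have cardT: "card ?T = q ^ r * (card (Units R))\<^sup>2"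
  proof -
    have "q ^ r = (q ^ l)\<^sup>2" unfolding r by (simp add: mult.commute flip: power_mult)
    then show ?thesis
      using level_card[of l] r by (simp add: card_split_subgroup power_mult_distrib)
  qed
  have "of_nat (card ?T) * ind_character ?G ?T ?\<chi> B =
      (\<Sum>x\<in>carrier ?G. if x \<otimes>\<^bsub>?G\<^esub> B \<otimes>\<^bsub>?G\<^esub> inv\<^bsub>?G\<^esub> x \<in> ?T then ?\<chi> (x \<otimes>\<^bsub>?G\<^esub> B \<otimes>\<^bsub>?G\<^esub> inv\<^bsub>?G\<^esub> x) else 0)"
    using r by (intro ind_character_frobenius GL2_group finG subgroup_split_subgroup boxtimes_mult one B_in_GL2) auto
  also have "\<dots> = (if i < l then 0 else \<Sum>x\<in>carrier ?G. summand x)"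
    using conj_B_notin_split_subgroup[of _ l] conj_B_in_split_subgroup[of _ l] l r by simp
  also have "(\<Sum>x\<in>carrier ?G. summand x) = (\<Sum>x\<in>?unit. summand x) + (\<Sum>x\<in>?non. summand x)"
    using finG by (subst sum.union_disjoint[symmetric]) (auto intro: sum.cong)
  also have "(if i < l then 0 else (\<Sum>x\<in>?unit. summand x) + (\<Sum>x\<in>?non. summand x)) =
      (if i = r - 1 then of_nat (card ?non) * (\<mu> \<alpha> * \<mu>' \<alpha>) else 0)"
  proof -
    have "(\<Sum>x\<in>?non. summand x) = of_nat (card ?non) * (\<mu> \<alpha> * \<mu>' \<alpha>)" if "i = r - 1"
      using summand_top[OF that] by simp
    then show ?thesis
      using sum_summand_unit_corner sum_summand_nonunit_corner i_le l r by auto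
  qed
  finally have "of_nat (card ?T) * ind_character ?G ?T ?\<chi> B =
      of_nat (card ?T) * ((if i = r - 1 then 1 else 0) * of_nat q ^ (r - 1) * \<mu> \<alpha> * \<mu>' \<alpha>)"
    unfolding card_GL2_nonunit_corner cardT by simp
  moreover have "card ?T \<noteq> 0" using cardT q cardU by simp
  ultimately show ?thesis by simp
qed

end

section \<open>Quotients of the valuation ring of a local field\<close>

context nonarch_local_field begin

lemma val_one: "v \<one> = 0"
  using val_mult[of \<one> \<one>] by simp

lemma val_uminus:
  assumes x: "x \<in> carrier F" "x \<noteq> \<zero>"
  shows "v (\<ominus> x) = v x"
proof -
  have nz: "\<ominus> \<one> \<noteq> \<zero>" by (metis add.inv_eq_1_iff one_closed one_not_zero)
  have "v (\<ominus> \<one>) + v (\<ominus> \<one>) = v (\<ominus> \<one> \<otimes> \<ominus> \<one>)"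
    using val_mult[of "\<ominus> \<one>" "\<ominus> \<one>"] nz by simp
  also have "\<ominus> \<one> \<otimes> \<ominus> \<one> = \<one>" by algebra
  finally have "v (\<ominus> \<one>) = 0" by (simp add: val_one)
  moreover have "\<ominus> x = \<ominus> \<one> \<otimes> x" using x(1) by (simp add: l_minus)
  ultimately show ?thesis using val_mult[of "\<ominus> \<one>" x] x nz by simp
qed

lemma val_ge_uminus: "x \<in> carrier F \<Longrightarrow> val_ge F v k x \<Longrightarrow> val_ge F v k (\<ominus> x)"
  using val_uminus[of x] by (cases "x = \<zero>") (auto simp: val_ge_def)

lemma val_ge_minus:
  "x \<in> carrier F \<Longrightarrow> y \<in> carrier F \<Longrightarrow> val_ge F v k x \<Longrightarrow> val_ge F v k y \<Longrightarrow> val_ge F v k (x \<ominus> y)"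
  unfolding minus_eq by (intro val_add val_ge_uminus a_inv_closed)

lemma val_ge_mult:
  assumes "x \<in> carrier F" "y \<in> carrier F" "val_ge F v j x" "val_ge F v k y"
  shows "val_ge F v (j + k) (x \<otimes> y)"
  using assms val_mult[of x y]
  by (cases "x = \<zero>"; cases "y = \<zero>") (auto simp: val_ge_def)

lemma val_ge_mono: "val_ge F v k x \<Longrightarrow> j \<le> k \<Longrightarrow> val_ge F v j x"
  unfolding val_ge_def by auto

abbreviation \<O> :: "('a, 'm) ring_scheme" where "\<O> \<equiv> val_ring F v"

lemma in_val_ring: "x \<in> carrier \<O> \<longleftrightarrow> x \<in> carrier F \<and> val_ge F v 0 x"
  by (simp add: val_ring_def)

lemma val_ring_ops:
  "x \<oplus>\<^bsub>\<O>\<^esub> y = x \<oplus> y" "x \<otimes>\<^bsub>\<O>\<^esub> y = x \<otimes> y" "\<zero>\<^bsub>\<O>\<^esub> = \<zero>" "\<one>\<^bsub>\<O>\<^esub> = \<one>"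
  by (simp_all add: val_ring_def)

lemma val_ring_pow: "x [^]\<^bsub>\<O>\<^esub> n = x [^] n" for n :: nat
  unfolding val_ring_def by (rule nat_pow_consistent[symmetric])

lemma val_ring_cring: "cring \<O>"
proof -
  have "subring (carrier \<O>) F"
  proof (rule subringI)
    fix x y assume "x \<in> carrier \<O>" "y \<in> carrier \<O>"
    then show "x \<otimes> y \<in> carrier \<O>" "x \<oplus> y \<in> carrier \<O>"
      using val_ge_mult[of x y 0 0] val_add by (simp_all add: in_val_ring)
  qed (auto simp: in_val_ring val_ge_uminus, simp add: val_ge_def val_one)
  then have "subcring (carrier \<O>) F" by (rule subcringI')
  then have "cring (F\<lparr>carrier := carrier \<O>\<rparr>)"
    using subcring_iff[OF subcringE(1)] by blast
  then show ?thesis by (simp add: val_ring_def)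
qed

text \<open>
  The subtraction of \<open>\<O>\<close> is defined through its own additive group, so it has to be identified with
  that of \<open>F\<close>.
\<close>

lemma val_ring_minus:
  assumes "x \<in> carrier \<O>" "y \<in> carrier \<O>"
  shows "x \<ominus>\<^bsub>\<O>\<^esub> y = x \<ominus> y"
proof -
  interpret O: cring \<O> by (rule val_ring_cring)
  have y: "y \<in> carrier F" "\<ominus> y \<in> carrier \<O>"
    using assms(2) val_ge_uminus by (auto simp: in_val_ring)
  have "\<ominus>\<^bsub>\<O>\<^esub> y = \<ominus> y"
    using O.minus_equality[of "\<ominus> y" y] y assms(2) by (simp add: val_ring_ops l_neg)
  then show ?thesis by (simp add: O.minus_eq minus_eq val_ring_ops)
qed

end

locale nonarch_local_field_uniformizer = nonarch_local_field +
  fixes w :: 'a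
  assumes uniformizer: "uniformizer F v w"
begin

lemma w_in_F: "w \<in> carrier F" and w_nonzero: "w \<noteq> \<zero>" and val_w: "v w = 1"
  using uniformizer by (auto simp: uniformizer_def)

lemma w_pow_nonzero: "w [^] n \<noteq> \<zero>" and val_w_pow: "v (w [^] n) = int n" for n :: nat
proof (induction n)
  case (Suc n)
  show "w [^] Suc n \<noteq> \<zero>" using Suc w_in_F w_nonzero by (simp add: integral_iff)
  show "v (w [^] Suc n) = int (Suc n)"
    using val_mult[of "w [^] n" w] Suc w_in_F w_nonzero val_w by simp
qed (simp_all add: val_one)

lemma w_pow_in_val_ring: "w [^] n \<in> carrier \<O>" for n :: nat
  using w_in_F val_w_pow[of n] by (simp add: in_val_ring val_ge_def)

lemma w_in_val_ring: "w \<in> carrier \<O>"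
  using w_in_F val_w by (simp add: in_val_ring val_ge_def)

lemma div_w_pow:
  assumes x: "x \<in> carrier F" "val_ge F v (int n) x"
  obtains y where "y \<in> carrier \<O>" "x = y \<otimes> w [^] n"
proof (cases "x = \<zero>")
  case True
  then show ?thesis using that[of \<zero>] w_in_F by (simp add: in_val_ring val_ge_def)
next
  case False
  have U: "w [^] n \<in> Units F" using w_in_F w_pow_nonzero by (simp add: field_Units)
  define y where "y = x \<otimes> inv (w [^] n)"
  have y: "y \<in> carrier F" "x = y \<otimes> w [^] n"
    using x U w_in_F by (simp_all add: y_def m_assoc)
  then have "y \<noteq> \<zero>" using False w_in_F by auto
  then have "v x = v y + int n" using val_mult[of y "w [^] n"] y w_in_F w_pow_nonzero val_w_pow by simp
  then have "y \<in> carrier \<O>" using x(2) y(1) False by (simp add: in_val_ring val_ge_def)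
  then show ?thesis using that y(2) by blast
qed

lemma trunc_ideal_eq: "trunc_ideal F v w n = {x \<in> carrier F. val_ge F v (int n) x}"
proof (intro equalityI subsetI)
  fix x assume "x \<in> trunc_ideal F v w n"
  then obtain y where y: "y \<in> carrier \<O>" "x = y \<otimes> w [^] n"
    by (auto simp: trunc_ideal_def cgenideal_def val_ring_ops val_ring_pow)
  then show "x \<in> {x \<in> carrier F. val_ge F v (int n) x}"
    using val_ge_mult[of y "w [^] n" 0 "int n"] w_in_F val_w_pow[of n]
    by (simp add: in_val_ring val_ge_def[of _ _ "int n" "w [^] n"])
next
  fix x assume "x \<in> {x \<in> carrier F. val_ge F v (int n) x}"
  then obtain y where "y \<in> carrier \<O>" "x = y \<otimes> w [^] n" using div_w_pow by blast
  then show "x \<in> trunc_ideal F v w n"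
    by (auto simp: trunc_ideal_def cgenideal_def val_ring_ops val_ring_pow)
qed

lemma val_ideal_eq: "val_ideal F v = trunc_ideal F v w 1"
  by (simp add: trunc_ideal_eq val_ideal_def)

lemma ideal_trunc_ideal: "ideal (trunc_ideal F v w n) \<O>"
  unfolding trunc_ideal_def val_ring_pow
  by (rule cring.cgenideal_ideal[OF val_ring_cring w_pow_in_val_ring])

abbreviation proj :: "nat \<Rightarrow> 'a \<Rightarrow> 'a set" where
  "proj n x \<equiv> trunc_ideal F v w n +>\<^bsub>\<O>\<^esub> x"

lemma proj_eq_iff:
  assumes "x \<in> carrier \<O>" "y \<in> carrier \<O>"
  shows "proj n x = proj n y \<longleftrightarrow> val_ge F v (int n) (x \<ominus> y)"
proof -
  interpret O: cring \<O> by (rule val_ring_cring)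
  have "x \<ominus> y \<in> carrier F" using assms by (simp add: in_val_ring)
  then show ?thesis
    using O.quotient_eq_iff_same_a_r_cos[OF ideal_trunc_ideal assms, of n] assms
    by (simp add: val_ring_minus trunc_ideal_eq)
qed

lemma trunc_ring_cring: "cring (trunc_ring F v w n)"
  unfolding trunc_ring_def by (rule ideal.quotient_is_cring[OF ideal_trunc_ideal val_ring_cring])

lemma trunc_ring_carrier: "carrier (trunc_ring F v w n) = proj n ` carrier \<O>"
  unfolding trunc_ring_def FactRing_def A_RCOSETS_def' by auto

lemma proj_ring_hom_ring: "ring_hom_ring \<O> (trunc_ring F v w n) (proj n)"
  unfolding trunc_ring_def by (rule ideal.rcos_ring_hom_ring[OF ideal_trunc_ideal])

lemma residue_field_eq: "residue_field F v = trunc_ring F v w 1"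
  by (simp add: residue_field_def trunc_ring_def val_ideal_eq)

text \<open>
  An element of \<open>\<O>\<close> is either a unit, when its valuation is zero, or a multiple of \<open>w\<close>, and a
  multiple of \<open>w\<close> stays a nonunit in the quotient because \<open>1\<close> has valuation zero and \<open>r > 0\<close>.
  The digits are images of representatives of the residue classes, since the residue field is the
  same construction with exponent one.
\<close>

lemma truncated_dvr_trunc_ring:
  assumes r: "0 < r"
  shows "truncated_dvr (trunc_ring F v w r) (trunc_unif F v w r) r (residue_card F v)"
proof -
  let ?R = "trunc_ring F v w r" and ?\<pi> = "proj r"
  interpret O: cring \<O> by (rule val_ring_cring)
  interpret R: cring ?R by (rule trunc_ring_cring)
  interpret \<pi>: ring_hom_ring \<O> ?R ?\<pi> by (rule proj_ring_hom_ring)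
  have t: "trunc_unif F v w r = ?\<pi> w" by (simp add: trunc_unif_def)
  have t_pow: "?\<pi> w [^]\<^bsub>?R\<^esub> n = ?\<pi> (w [^] n)" for n :: nat
    using \<pi>.hom_nat_pow[OF w_in_val_ring, of n] by (simp add: val_ring_pow)
  have zero: "\<zero>\<^bsub>?R\<^esub> = ?\<pi> \<zero>" using \<pi>.hom_zero by (simp add: val_ring_ops)
  have one: "\<one>\<^bsub>?R\<^esub> = ?\<pi> \<one>" using \<pi>.hom_one by (simp add: val_ring_ops)
  have zero_in: "\<zero> \<in> carrier \<O>" and one_in: "\<one> \<in> carrier \<O>"
    using O.zero_closed O.one_closed by (simp_all add: val_ring_ops)
  have in_F: "x \<in> carrier F" if "x \<in> carrier \<O>" for x using that by (simp add: in_val_ring)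
  have \<pi>_mult: "?\<pi> x \<otimes>\<^bsub>?R\<^esub> ?\<pi> y = ?\<pi> (x \<otimes> y)" if "x \<in> carrier \<O>" "y \<in> carrier \<O>" for x y
    using \<pi>.hom_mult[OF that] by (simp add: val_ring_ops)
  have \<pi>_add: "?\<pi> x \<oplus>\<^bsub>?R\<^esub> ?\<pi> y = ?\<pi> (x \<oplus> y)" if "x \<in> carrier \<O>" "y \<in> carrier \<O>" for x y
    using \<pi>.hom_add[OF that] by (simp add: val_ring_ops)
  have O_mult: "x \<otimes> y \<in> carrier \<O>" if "x \<in> carrier \<O>" "y \<in> carrier \<O>" for x y
    using O.m_closed[OF that] by (simp add: val_ring_ops)
  have O_add: "x \<oplus> y \<in> carrier \<O>" if "x \<in> carrier \<O>" "y \<in> carrier \<O>" for x y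
    using O.a_closed[OF that] by (simp add: val_ring_ops)
  have val_w_mult: "val_ge F v 1 (w \<otimes> y)" if "y \<in> carrier \<O>" for y
    using val_ge_mult[of w y 1 0] that w_in_F val_w by (simp add: in_val_ring val_ge_def[of _ _ 1 w])
  show ?thesis unfolding t
  proof
    show "?\<pi> w \<in> carrier ?R" using w_in_val_ring by (simp add: trunc_ring_carrier)
    show "?\<pi> w [^]\<^bsub>?R\<^esub> r = \<zero>\<^bsub>?R\<^esub>"
      unfolding t_pow zero using w_in_F val_w_pow[of r]
      by (simp add: proj_eq_iff w_pow_in_val_ring zero_in val_ge_def minus_eq)
    show "?\<pi> w [^]\<^bsub>?R\<^esub> (r - 1) \<noteq> \<zero>\<^bsub>?R\<^esub>"
      unfolding t_pow zero using w_in_F val_w_pow[of "r - 1"] w_pow_nonzero[of "r - 1"] r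
      by (simp add: proj_eq_iff w_pow_in_val_ring zero_in val_ge_def minus_eq)
  next
    fix X assume "X \<in> carrier ?R"
    then obtain x where x: "x \<in> carrier \<O>" "X = ?\<pi> x" by (auto simp: trunc_ring_carrier)
    show "X \<notin> Units ?R \<longleftrightarrow> (\<exists>Y\<in>carrier ?R. X = ?\<pi> w \<otimes>\<^bsub>?R\<^esub> Y)"
    proof
      assume nonunit: "X \<notin> Units ?R"
      have "val_ge F v 1 x"
      proof (rule ccontr)
        assume "\<not> val_ge F v 1 x"
        then have nz: "x \<noteq> \<zero>" and vx: "v x = 0" using x(1) by (auto simp: in_val_ring val_ge_def)
        have U: "x \<in> Units F" using nz in_F[OF x(1)] by (simp add: field_Units)
        have inv: "inv x \<in> carrier F" "x \<otimes> inv x = \<one>" using U by simp_all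
        have "inv x \<noteq> \<zero>" using inv(2) in_F[OF x(1)] by auto
        then have "v (inv x) = 0" using val_mult[of x "inv x"] in_F[OF x(1)] inv nz vx val_one by simp
        then have y: "inv x \<in> carrier \<O>" using inv(1) by (simp add: in_val_ring val_ge_def)
        have "X \<otimes>\<^bsub>?R\<^esub> ?\<pi> (inv x) = \<one>\<^bsub>?R\<^esub>"
          unfolding x(2) \<pi>_mult[OF x(1) y] inv(2) one ..
        moreover have "X \<in> carrier ?R" "?\<pi> (inv x) \<in> carrier ?R"
          using x y by (simp_all add: trunc_ring_carrier)
        moreover from this have "?\<pi> (inv x) \<otimes>\<^bsub>?R\<^esub> X = X \<otimes>\<^bsub>?R\<^esub> ?\<pi> (inv x)"
          by (intro R.m_comm)
        ultimately have "X \<in> Units ?R" unfolding Units_def by auto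
        then show False using nonunit by simp
      qed
      then obtain y where y: "y \<in> carrier \<O>" "x = y \<otimes> w"
        using div_w_pow[of x 1] in_F[OF x(1)] w_in_F by auto
      then have "X = ?\<pi> w \<otimes>\<^bsub>?R\<^esub> ?\<pi> y"
        unfolding x(2) \<pi>_mult[OF w_in_val_ring y(1)] using in_F[OF y(1)] w_in_F by (simp add: m_comm)
      then show "\<exists>Y\<in>carrier ?R. X = ?\<pi> w \<otimes>\<^bsub>?R\<^esub> Y"
        using y(1) by (auto simp: trunc_ring_carrier)
    next
      assume "\<exists>Y\<in>carrier ?R. X = ?\<pi> w \<otimes>\<^bsub>?R\<^esub> Y"
      then obtain y where y: "y \<in> carrier \<O>" "X = ?\<pi> w \<otimes>\<^bsub>?R\<^esub> ?\<pi> y"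
        by (auto simp: trunc_ring_carrier)
      show "X \<notin> Units ?R"
      proof
        assume "X \<in> Units ?R"
        then obtain Z where "Z \<in> carrier ?R" "X \<otimes>\<^bsub>?R\<^esub> Z = \<one>\<^bsub>?R\<^esub>"
          using R.Units_r_inv_ex by blast
        then obtain z where z: "z \<in> carrier \<O>" "X \<otimes>\<^bsub>?R\<^esub> ?\<pi> z = ?\<pi> \<one>"
          by (auto simp: trunc_ring_carrier one)
        let ?p = "w \<otimes> y \<otimes> z"
        have p: "?p \<in> carrier \<O>" using w_in_val_ring y z by (simp add: O_mult)
        have "?\<pi> ?p = ?\<pi> \<one>"
          using z y w_in_val_ring by (simp add: \<pi>_mult O_mult)
        then have "val_ge F v (int r) (?p \<ominus> \<one>)" using proj_eq_iff[OF p one_in] by simp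
        then have 1: "val_ge F v 1 (?p \<ominus> \<one>)" using r by (elim val_ge_mono) simp
        have 2: "val_ge F v 1 ?p"
          using val_w_mult[of "y \<otimes> z"] y(1) z(1) O_mult in_F w_in_F by (simp add: m_assoc)
        have "\<one> = ?p \<ominus> (?p \<ominus> \<one>)" using in_F[OF p] by algebra
        then have "val_ge F v 1 \<one>" using val_ge_minus[OF _ _ 2 1] in_F[OF p] by simp
        then show False by (simp add: val_ge_def val_one)
      qed
    qed
  next
    let ?K = "carrier (residue_field F v)"
    have K: "?K = proj 1 ` carrier \<O>" by (simp add: residue_field_eq trunc_ring_carrier)
    define rep where "rep = (\<lambda>k. SOME x. x \<in> carrier \<O> \<and> proj 1 x = k)"
    have rep: "rep k \<in> carrier \<O>" "proj 1 (rep k) = k" if "k \<in> ?K" for k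
      using someI_ex[of "\<lambda>x. x \<in> carrier \<O> \<and> proj 1 x = k"] that unfolding K rep_def by auto
    define C where "C = (\<lambda>k. ?\<pi> (rep k)) ` ?K"
    have same: "k = k'" if k: "k \<in> ?K" "k' \<in> ?K" and y: "y \<in> carrier \<O>"
      and eq: "?\<pi> (rep k) = ?\<pi> (rep k' \<oplus> w \<otimes> y)" for k k' y
    proof -
      let ?x = "rep k" and ?x' = "rep k'"
      note x = rep(1)[OF k(1)] rep(1)[OF k(2)]
      have wy: "w \<otimes> y \<in> carrier \<O>" using w_in_val_ring y by (rule O_mult)
      have "val_ge F v (int r) (?x \<ominus> (?x' \<oplus> w \<otimes> y))"
        using eq proj_eq_iff[OF x(1) O_add[OF x(2) wy]] by simp
      then have "val_ge F v 1 (?x \<ominus> (?x' \<oplus> w \<otimes> y))" using r by (elim val_ge_mono) simp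
      then have "val_ge F v 1 ((?x \<ominus> (?x' \<oplus> w \<otimes> y)) \<oplus> w \<otimes> y)"
        using val_add val_w_mult[OF y] x wy in_F by simp
      also have "(?x \<ominus> (?x' \<oplus> w \<otimes> y)) \<oplus> w \<otimes> y = ?x \<ominus> ?x'"
        using in_F[OF x(1)] in_F[OF x(2)] in_F[OF wy] by algebra
      finally have "proj 1 ?x = proj 1 ?x'" using proj_eq_iff[OF x, of 1] by simp
      then show "k = k'" using rep(2) k by simp
    qed
    have inj: "inj_on (\<lambda>k. ?\<pi> (rep k)) ?K"
    proof (rule inj_onI)
      fix k k' assume k: "k \<in> ?K" "k' \<in> ?K" and eq: "?\<pi> (rep k) = ?\<pi> (rep k')"
      have "rep k' \<oplus> w \<otimes> \<zero> = rep k'" using in_F[OF rep(1)[OF k(2)]] w_in_F by simp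
      then show "k = k'" using same[OF k zero_in] eq by simp
    qed
    have "C \<subseteq> carrier ?R" using rep(1) by (auto simp: C_def trunc_ring_carrier)
    moreover have "finite C" using finite_residue_field by (simp add: C_def)
    moreover have "card C = residue_card F v"
      unfolding C_def residue_card_def by (rule card_image[OF inj])
    moreover have "\<forall>X\<in>carrier ?R. \<exists>c\<in>C. \<exists>Y\<in>carrier ?R. X = c \<oplus>\<^bsub>?R\<^esub> ?\<pi> w \<otimes>\<^bsub>?R\<^esub> Y"
    proof
      fix X assume "X \<in> carrier ?R"
      then obtain x where x: "x \<in> carrier \<O>" "X = ?\<pi> x" by (auto simp: trunc_ring_carrier)
      have k: "proj 1 x \<in> ?K" unfolding K using x(1) by blast
      let ?y = "rep (proj 1 x)"
      note y = rep[OF k]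
      have "val_ge F v (int 1) (x \<ominus> ?y)" using proj_eq_iff[OF x(1) y(1), of 1] y(2) by simp
      then obtain u where u: "u \<in> carrier \<O>" "x \<ominus> ?y = u \<otimes> w [^] (1::nat)"
        using div_w_pow[of "x \<ominus> ?y" 1] in_F[OF x(1)] in_F[OF y(1)] by auto
      have "x = ?y \<oplus> (x \<ominus> ?y)" using in_F[OF x(1)] in_F[OF y(1)] by algebra
      also have "x \<ominus> ?y = w \<otimes> u" using u w_in_F in_F[OF u(1)] by (simp add: m_comm)
      finally have "X = ?\<pi> ?y \<oplus>\<^bsub>?R\<^esub> ?\<pi> w \<otimes>\<^bsub>?R\<^esub> ?\<pi> u"
        using x(2) y(1) u(1) w_in_val_ring by (simp add: \<pi>_mult \<pi>_add O_mult)
      moreover have "?\<pi> ?y \<in> C" using k by (simp add: C_def)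
      moreover have "?\<pi> u \<in> carrier ?R" using u(1) by (simp add: trunc_ring_carrier)
      ultimately show "\<exists>c\<in>C. \<exists>Y\<in>carrier ?R. X = c \<oplus>\<^bsub>?R\<^esub> ?\<pi> w \<otimes>\<^bsub>?R\<^esub> Y" by blast
    qed
    moreover have "\<forall>c\<in>C. \<forall>c'\<in>C. \<forall>Y\<in>carrier ?R. c = c' \<oplus>\<^bsub>?R\<^esub> ?\<pi> w \<otimes>\<^bsub>?R\<^esub> Y \<longrightarrow> c = c'"
    proof (intro ballI impI)
      fix c c' Y assume "c \<in> C" "c' \<in> C" "Y \<in> carrier ?R" and eq: "c = c' \<oplus>\<^bsub>?R\<^esub> ?\<pi> w \<otimes>\<^bsub>?R\<^esub> Y"
      then obtain k k' y where k: "k \<in> ?K" "k' \<in> ?K" and y: "y \<in> carrier \<O>"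
        and c: "c = ?\<pi> (rep k)" "c' = ?\<pi> (rep k')" "Y = ?\<pi> y"
        by (auto simp: C_def trunc_ring_carrier)
      have "?\<pi> (rep k) = ?\<pi> (rep k' \<oplus> w \<otimes> y)"
        using eq k y rep(1) w_in_val_ring unfolding c by (simp add: \<pi>_mult \<pi>_add O_mult)
      then have "k = k'" by (rule same[OF k y])
      then show "c = c'" by (simp add: c)
    qed
    ultimately show "\<exists>C\<subseteq>carrier ?R. finite C \<and> card C = residue_card F v \<and>
        (\<forall>X\<in>carrier ?R. \<exists>c\<in>C. \<exists>Y\<in>carrier ?R. X = c \<oplus>\<^bsub>?R\<^esub> ?\<pi> w \<otimes>\<^bsub>?R\<^esub> Y) \<and>
        (\<forall>c\<in>C. \<forall>c'\<in>C. \<forall>Y\<in>carrier ?R. c = c' \<oplus>\<^bsub>?R\<^esub> ?\<pi> w \<otimes>\<^bsub>?R\<^esub> Y \<longrightarrow> c = c')"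
      by blast
  qed
qed

end

section \<open>The character values\<close>

theorem proposition10:
  fixes F :: "('a, 'm) ring_scheme" and v :: "'a \<Rightarrow> int" and w :: 'a
    and r i :: nat
    and R :: "'a set ring" and t :: "'a set"
    and \<mu> \<mu>' :: "'a set \<Rightarrow> complex" and \<alpha> \<beta> :: "'a set"
  assumes "nonarch_local_field F v"
    and "uniformizer F v w"
    and "residue_char F v \<noteq> 2"
    and "r \<ge> 2" and "even r"
    and "R = trunc_ring F v w r"
    and "t = trunc_unif F v w r"
    and "regular_couple R t r \<mu> \<mu>'"
    and "i \<le> r - 1"
    and "\<alpha> \<in> Units R" and "\<beta> \<in> carrier R"
  shows "principal_split_character R t r \<mu> \<mu>' (B_mat R t i \<alpha> \<beta>) =
    (if i = r - 1 then 1 else 0) * of_nat (residue_card F v) ^ (r - 1) * \<mu> \<alpha> * \<mu>' \<alpha>"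
proof -
  interpret nonarch_local_field_uniformizer F v w
    using assms(1,2) by (simp add: nonarch_local_field_uniformizer_def nonarch_local_field_uniformizer_axioms_def)
  have "truncated_dvr R t r (residue_card F v)"
    using truncated_dvr_trunc_ring[of r] assms(4,6,7) by simp
  then interpret P: principal_split_trace R t r "residue_card F v" \<mu> \<mu>' i \<alpha> \<beta>
    using assms(4,8-11)
    by (intro principal_split_trace.intro regular_characters.intro
        principal_split_trace_axioms.intro regular_characters_axioms.intro)
  have "r = 2 * (r div 2)" using assms(5) by simp
  then show ?thesis
    unfolding principal_split_character_def by (rule P.ind_character_B)
qed

end
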